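(* Let $k$ be a knot in $S^3$ and let $b_r$, $r\ge1$, be its torsion numbers. Then either the sequence $\{b_r\}$ is periodic, or else for any $N>0$ there exists an $r$ such that the factorization of $b_r$ has at least $N$ distinct primes.
   Context: A knot is a simple closed curve in the $3$-sphere $S^3$ (tame, as usual). For a knot $k$ and positive integer $r$, let $M_r$ be the $r$-fold cyclic cover of $S^3$ branched over $k$. The $r$th torsion number $b_r$ of $k$ is the order of the torsion subgroup of $H_1(M_r;\mathbb{Z})$. Equivalently: let $G=\pi_1(S^3-k)$, let $\chi:G\to\mathbb{Z}$ be the abelianization, and let $\mathcal{M}$ be the abelianization of $\ker\chi$, a module over $\mathbb{Z}[t,t^{-1}]$ with $t$ acting by conjugation by an element $x$ with $\chi(x)=1$; then $H_1(M_r;\mathbb{Z})\cong\mathcal{M}/(t^r-1)\mathcal{M}$. *)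

theory Defs
  imports
    "HOL-Analysis.Analysis"
    "HOL-Algebra.Algebra"
    "HOL-Computational_Algebra.Primes"
begin

section \<open>Tame knots in the 3-sphere\<close>

definition S3 :: "(real ^ 4) set" where
  "S3 = sphere 0 1"

definition knot :: "(real ^ 4) set \<Rightarrow> bool" where
  "knot k \<longleftrightarrow> k \<subseteq> S3 \<and>
     (\<exists>c. simple_path c \<and> pathfinish c = pathstart c \<and> path_image c = k)"

definition polygonal :: "'a::real_vector set \<Rightarrow> bool" where
  "polygonal K \<longleftrightarrow> (\<exists>E. finite E \<and> K = (\<Union>(u, v)\<in>E. closed_segment u v))"

text \<open>
  A knot is tame if it is equivalent to a polygonal knot. Here the sphere is viewed as the
  one-point compactification of Euclidean 3-space: some point \<open>p\<close> off the knot plays the role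
  of infinity, and a homeomorphism from the rest of the sphere onto 3-space (which extends over
  \<open>p\<close>) straightens the knot to a polygon.
\<close>

definition tame_knot :: "(real ^ 4) set \<Rightarrow> bool" where
  "tame_knot k \<longleftrightarrow> knot k \<and>
     (\<exists>p \<in> S3 - k. \<exists>(f :: real ^ 4 \<Rightarrow> real ^ 3) g.
        homeomorphism (S3 - {p}) UNIV f g \<and> polygonal (f ` k))"


section \<open>The fundamental group\<close>

definition based_loops :: "'a::topological_space set \<Rightarrow> 'a \<Rightarrow> (real \<Rightarrow> 'a) set" where
  "based_loops S a =
     {p. path p \<and> path_image p \<subseteq> S \<and> pathstart p = a \<and> pathfinish p = a}"

definition path_class :: "'a::topological_space set \<Rightarrow> (real \<Rightarrow> 'a) \<Rightarrow> (real \<Rightarrow> 'a) set" where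
  "path_class S p = {q. homotopic_paths S p q}"

definition fundamental_group ::
    "'a::real_normed_vector set \<Rightarrow> 'a \<Rightarrow> (real \<Rightarrow> 'a) set monoid" where
  "fundamental_group S a =
     \<lparr>carrier = path_class S ` based_loops S a,
      mult = (\<lambda>A B. \<Union>p\<in>A. \<Union>q\<in>B. path_class S (p +++ q)),
      one = path_class S (linepath a a)\<rparr>"

lemma path_class_eqI:
  assumes "homotopic_paths S p q"
  shows "path_class S p = path_class S q"
  unfolding path_class_def
  using assms homotopic_paths_sym homotopic_paths_trans by blast

lemma fundamental_group_mult:
  assumes p: "p \<in> based_loops S a" and q: "q \<in> based_loops S a"
  shows "path_class S p \<otimes>\<^bsub>fundamental_group S a\<^esub> path_class S q = path_class S (p +++ q)"
proof -
  have eq: "path_class S (p' +++ q') = path_class S (p +++ q)"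
    if "homotopic_paths S p p'" "homotopic_paths S q q'" for p' q'
  proof -
    have "homotopic_paths S (p +++ q) (p' +++ q')"
      using that p q by (intro homotopic_paths_join) (auto simp: based_loops_def)
    then have "path_class S (p +++ q) = path_class S (p' +++ q')"
      by (rule path_class_eqI)
    then show ?thesis ..
  qed
  have "p \<in> path_class S p" "q \<in> path_class S q"
    using p q by (auto simp: based_loops_def path_class_def)
  then have "(\<Union>p'\<in>path_class S p. \<Union>q'\<in>path_class S q. path_class S (p' +++ q'))
      = (\<Union>p'\<in>path_class S p. \<Union>q'\<in>path_class S q. path_class S (p +++ q))"
    by (intro SUP_cong refl eq) (simp_all add: path_class_def)
  also have "\<dots> = path_class S (p +++ q)"
    using \<open>p \<in> path_class S p\<close> \<open>q \<in> path_class S q\<close> by blast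
  finally show ?thesis
    by (simp add: fundamental_group_def)
qed

lemma group_fundamental_group:
  assumes "a \<in> S"
  shows "group (fundamental_group S a)"
proof (rule groupI)
  let ?G = "fundamental_group S a"
  have carr: "carrier ?G = path_class S ` based_loops S a"
    and one: "\<one>\<^bsub>?G\<^esub> = path_class S (linepath a a)"
    by (simp_all add: fundamental_group_def)
  have join: "p +++ q \<in> based_loops S a" if "p \<in> based_loops S a" "q \<in> based_loops S a" for p q
    using that by (auto simp: based_loops_def path_image_join)
  have const: "linepath a a \<in> based_loops S a"
    using assms by (auto simp: based_loops_def)
  show "x \<otimes>\<^bsub>?G\<^esub> y \<in> carrier ?G" if "x \<in> carrier ?G" "y \<in> carrier ?G" for x y
    using that join by (auto simp: carr fundamental_group_mult)
  show "\<one>\<^bsub>?G\<^esub> \<in> carrier ?G"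
    using const by (simp add: carr one)
  show "x \<otimes>\<^bsub>?G\<^esub> y \<otimes>\<^bsub>?G\<^esub> z = x \<otimes>\<^bsub>?G\<^esub> (y \<otimes>\<^bsub>?G\<^esub> z)"
    if xyz: "x \<in> carrier ?G" "y \<in> carrier ?G" "z \<in> carrier ?G" for x y z
  proof -
    obtain p q r where *: "x = path_class S p" "y = path_class S q" "z = path_class S r"
      and pqr: "p \<in> based_loops S a" "q \<in> based_loops S a" "r \<in> based_loops S a"
      using xyz by (auto simp: carr)
    have "homotopic_paths S (p +++ (q +++ r)) ((p +++ q) +++ r)"
      using pqr by (intro homotopic_paths_assoc) (auto simp: based_loops_def)
    then have "path_class S (p +++ (q +++ r)) = path_class S ((p +++ q) +++ r)"
      by (rule path_class_eqI)
    then show ?thesis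
      using pqr join by (simp add: * fundamental_group_mult)
  qed
  show "\<one>\<^bsub>?G\<^esub> \<otimes>\<^bsub>?G\<^esub> x = x" if x: "x \<in> carrier ?G" for x
  proof -
    obtain p where *: "x = path_class S p" and p: "p \<in> based_loops S a"
      using x by (auto simp: carr)
    have "homotopic_paths S (linepath a a +++ p) p"
      using p homotopic_paths_lid[of p S] by (auto simp: based_loops_def)
    then have "path_class S (linepath a a +++ p) = path_class S p"
      by (rule path_class_eqI)
    then show ?thesis
      using p const by (simp add: * one fundamental_group_mult)
  qed
  show "\<exists>y\<in>carrier ?G. y \<otimes>\<^bsub>?G\<^esub> x = \<one>\<^bsub>?G\<^esub>" if x: "x \<in> carrier ?G" for x
  proof -
    obtain p where *: "x = path_class S p" and p: "p \<in> based_loops S a"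
      using x by (auto simp: carr)
    have rp: "reversepath p \<in> based_loops S a"
      using p by (auto simp: based_loops_def)
    have "homotopic_paths S (reversepath p +++ p) (linepath a a)"
      using p homotopic_paths_linv[of p S] by (auto simp: based_loops_def)
    then have "path_class S (reversepath p +++ p) = path_class S (linepath a a)"
      by (rule path_class_eqI)
    then have "path_class S (reversepath p) \<otimes>\<^bsub>?G\<^esub> x = \<one>\<^bsub>?G\<^esub>"
      using p rp by (simp add: * one fundamental_group_mult)
    then show ?thesis
      using rp carr by blast
  qed
qed


section \<open>Torsion numbers\<close>

definition abelianization :: "('a, 'b) monoid_scheme \<Rightarrow> 'a set monoid" where
  "abelianization G = G Mod (derived G (carrier G))"

text \<open>\<open>\<phi>\<close> exhibits the integers as the abelianization of \<open>G\<close>.\<close>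

definition is_abelianization_int :: "('a, 'b) monoid_scheme \<Rightarrow> ('a \<Rightarrow> int) \<Rightarrow> bool" where
  "is_abelianization_int G \<phi> \<longleftrightarrow>
     \<phi> \<in> epi G integer_group \<and> kernel G integer_group \<phi> = derived G (carrier G)"

text \<open>The abelianization of \<open>ker \<phi>\<close>; its elements are cosets of the commutator
  subgroup of \<open>ker \<phi>\<close>.\<close>

definition kernel_ab :: "('a, 'b) monoid_scheme \<Rightarrow> ('a \<Rightarrow> int) \<Rightarrow> 'a set monoid" where
  "kernel_ab G \<phi> = abelianization (G\<lparr>carrier := kernel G integer_group \<phi>\<rparr>)"

text \<open>The action of \<open>t\<close> on \<open>kernel_ab G \<phi>\<close>: conjugation by \<open>x\<close> permutes
  the cosets of the commutator subgroup of \<open>ker \<phi>\<close>.\<close>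

definition conj_act :: "('a, 'b) monoid_scheme \<Rightarrow> 'a \<Rightarrow> 'a set \<Rightarrow> 'a set" where
  "conj_act G x A = (\<lambda>g. x \<otimes>\<^bsub>G\<^esub> g \<otimes>\<^bsub>G\<^esub> inv\<^bsub>G\<^esub> x) ` A"

text \<open>The submodule \<open>(t ^ r - 1) M\<close> of \<open>M = kernel_ab G \<phi>\<close> (written multiplicatively), and the
  quotient by it.\<close>

definition power_minus_one_image ::
    "('a, 'b) monoid_scheme \<Rightarrow> ('a \<Rightarrow> int) \<Rightarrow> 'a \<Rightarrow> nat \<Rightarrow> 'a set set" where
  "power_minus_one_image G \<phi> x r =
     (\<lambda>m. (conj_act G x ^^ r) m \<otimes>\<^bsub>kernel_ab G \<phi>\<^esub> inv\<^bsub>kernel_ab G \<phi>\<^esub> m)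
        ` carrier (kernel_ab G \<phi>)"

definition cyclic_quotient ::
    "('a, 'b) monoid_scheme \<Rightarrow> ('a \<Rightarrow> int) \<Rightarrow> 'a \<Rightarrow> nat \<Rightarrow> 'a set set monoid" where
  "cyclic_quotient G \<phi> x r = kernel_ab G \<phi> Mod power_minus_one_image G \<phi> x r"

definition torsion_part :: "('a, 'b) monoid_scheme \<Rightarrow> 'a set" where
  "torsion_part H = {h \<in> carrier H. \<exists>n::nat. n > 0 \<and> h [^]\<^bsub>H\<^esub> n = \<one>\<^bsub>H\<^esub>}"

text \<open>
  When \<open>G\<close> is the group of a knot \<open>k\<close>, \<open>\<phi>\<close> its abelianization and \<open>\<phi> x = 1\<close>, the group
  \<open>cyclic_quotient G \<phi> x r\<close> is the first integral homology of the \<open>r\<close>-fold cyclic cover of the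
  3-sphere branched over \<open>k\<close>. It is finitely generated, so its torsion subgroup is finite.
\<close>

definition torsion_number ::
    "('a, 'b) monoid_scheme \<Rightarrow> ('a \<Rightarrow> int) \<Rightarrow> 'a \<Rightarrow> nat \<Rightarrow> nat" where
  "torsion_number G \<phi> x r = card (torsion_part (cyclic_quotient G \<phi> x r))"

end

theory Submission
  imports Defs "HOL-Computational_Algebra.Polynomial"
begin

text \<open>
  Let \<open>M\<close> be the abelianization of the commutator subgroup of the knot group \<open>G\<close>, a module over
  \<open>\<int>[t, 1/t]\<close>. It is finitely generated because \<open>G\<close> is: the complement of a polygon is a finite
  union of open convex sets. Since \<open>\<int>\<close> is the abelianization of \<open>G\<close>, \<open>t - 1\<close> maps \<open>M\<close> onto itself,
  so by Nakayama a polynomial \<open>D\<close> with \<open>D(1) = 1\<close> annihilates \<open>M\<close>. Hence \<open>M/pM\<close> is finite for every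
  prime \<open>p\<close>, and \<open>t\<close> acts on it with finite order.

  Fix primes \<open>p\<close> not dividing the extreme coefficients of \<open>D\<close>, as many as desired, and let \<open>r\<close> be a
  common multiple of the orders of \<open>t\<close> on the groups \<open>M/pM\<close>. Then \<open>(t^r - 1)M\<close> lies in every \<open>pM\<close>.
  If one of these primes did not divide \<open>b_r\<close>, then \<open>M/(t^r - 1)M\<close> would have no \<open>p\<close>-torsion, so
  \<open>(t^r - 1)M\<close> would be \<open>p\<close>-divisible. As \<open>M\<close> becomes finitely generated over \<open>\<int>\<close> after inverting
  the extreme coefficients of \<open>D\<close>, this makes \<open>(t^r - 1)M\<close> a torsion group of bounded exponent, hence
  finite, and \<open>t\<close> has finite order on \<open>M\<close>; in that case the torsion numbers are periodic.
\<close>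

text \<open>\<open>M\<close> need not be finitely generated over the integers; this is why the
  finiteness arguments pass through the extreme coefficients of an annihilator, which rewrite high
  and negative powers of \<open>t\<close>. The condition \<open>D(1) = 1\<close> keeps
  \<open>D\<close> nonzero modulo every prime. Finite order of \<open>t\<close> comes from a finite
  image \<open>(t^s - 1)M\<close> as follows: some power \<open>y\<close> of \<open>t\<close>
  satisfies \<open>(y - 1)^2 = 0\<close> and \<open>m (y - 1) = 0\<close> on \<open>M\<close>, so
  \<open>y^m = 1\<close>. The module arguments form no quotients and never invert \<open>t\<close>:
  they run on a whole type modulo a submodule \<open>R\<close>, with polynomials acting and
  \<open>t\<close> bijective modulo \<open>R\<close>. For a knot the type is the free abelian group
  on the type of the elements of \<open>M\<close>, and \<open>R\<close> is the kernel of evaluation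
  in \<open>M\<close>.\<close>

no_notation vector_scalar_mult (infixl \<open>*s\<close> 70)

section \<open>Finitely generated modules\<close>

context Modules.module begin

text \<open>Elimination in place of determinants: a multiplier \<open>f = r ^ N + q * h\<close>
  carries \<open>S\<close> into \<open>span (T \<union> U)\<close>, at the outset with
  \<open>T = S\<close> and \<open>f = 1\<close>, and the relations of the generators shrink
  \<open>T\<close> to the empty set. It serves twice: with \<open>q = t - 1\<close> and
  \<open>r\<close> a power of \<open>t\<close>, and over the integers with \<open>q\<close> a prime
  and \<open>r\<close> a power of \<open>e\<close>.\<close>

lemma nakayama:
  assumes "finite S" and U: "subspace U"
    and rel: "\<And>g. g \<in> S \<Longrightarrow> \<exists>w\<in>span S. r *s g - q *s w \<in> U"
  shows "\<exists>N h. \<forall>g\<in>S. (r ^ N + q * h) *s g \<in> U"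
proof -
  have "\<exists>N h. \<forall>g\<in>S. (r ^ N + q * h) *s g \<in> U"
    if "finite T" "T \<subseteq> S" "\<exists>N h. \<forall>g\<in>S. (r ^ N + q * h) *s g \<in> span (T \<union> U)" for T
    using that
  proof (induction T rule: finite_induct)
    case empty
    with U show ?case by (simp add: span_eq_iff[THEN iffD2])
  next
    case (insert x T)
    then obtain N h where *: "\<forall>g\<in>S. (r ^ N + q * h) *s g \<in> span (insert x (T \<union> U))"
      by auto
    define f where "f = r ^ N + q * h"
    have sub: "f *s w \<in> span (insert x (T \<union> U))" if "w \<in> span S" for w
      using that
    proof (induction rule: span_induct)
      case base
      have "{v. f *s v \<in> span (insert x (T \<union> U))} = (\<lambda>v. f *s v) -` span (insert x (T \<union> U))"
        by auto
      then show ?case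
        by (auto simp: subspace_def scale_right_distrib span_zero span_add
            scale_left_commute[of f] span_scale simp del: scale_scale)
    qed (use * f_def in auto)
    obtain w where w: "w \<in> span S" "r *s x - q *s w \<in> U"
      using rel insert.prems by blast
    obtain c where c: "f *s w - c *s x \<in> span (T \<union> U)"
      using sub[OF w(1)] by (auto simp: span_insert)
    \<comment> \<open>Here \<open>r x = q w\<close> modulo \<open>U\<close> and
      \<open>f w = c x\<close> modulo \<open>span (T \<union> U)\<close>. Multiplying the former by
      \<open>f\<close> and substituting gives \<open>(r f - q c) x = 0\<close>, which removes
      \<open>x\<close> from the spanning set.\<close>
    have "f *s (r *s x - q *s w) + q *s (f *s w - c *s x) \<in> span (T \<union> U)"
      by (intro span_add span_scale c) (use w in \<open>auto intro: span_base\<close>)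
    also have "f *s (r *s x - q *s w) + q *s (f *s w - c *s x) = (r * f - q * c) *s x"
      by (simp add: algebra_simps)
    finally have x: "(r * f - q * c) *s x \<in> span (T \<union> U)" .
    have "((r * f - q * c) * f) *s g \<in> span (T \<union> U)" if g: "g \<in> S" for g
    proof -
      obtain d where d: "f *s g - d *s x \<in> span (T \<union> U)"
        using * g by (auto simp: span_insert f_def)
      have "(r * f - q * c) *s (f *s g - d *s x) + d *s ((r * f - q * c) *s x) \<in> span (T \<union> U)"
        by (intro span_add span_scale d x)
      then show ?thesis
        by (simp add: algebra_simps)
    qed
    \<comment> \<open>The shape of the multiplier persists: modulo \<open>q\<close> the product is
      \<open>r * r ^ N * r ^ N\<close>.\<close>
    moreover have "(r * f - q * c) * f =
        r ^ Suc (N + N) + q * ((r * h - c) * f + r ^ Suc N * h)"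
      by (simp add: f_def algebra_simps power_add)
    ultimately have "\<exists>N h. \<forall>g\<in>S. (r ^ N + q * h) *s g \<in> span (T \<union> U)"
      by metis
    then show ?case
      using insert by blast
  qed
  moreover have "\<exists>N h. \<forall>g\<in>S. (r ^ N + q * h) *s g \<in> span (S \<union> U)"
    by (rule exI[of _ 0], rule exI[of _ 0]) (auto intro: span_base)
  ultimately show ?thesis
    using \<open>finite S\<close> by blast
qed

end

section \<open>Integer modules: torsion and finite quotients\<close>

locale int_module = Modules.module scale
  for scale :: "int \<Rightarrow> 'm::ab_group_add \<Rightarrow> 'm" (infixr "*z" 75)
begin

text \<open>Modulo \<open>U\<close> the span is cyclic: either finite, represented by the first
  \<open>m\<close> multiples of \<open>g\<close>, or infinite cyclic, where \<open>0\<close> is the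
  only torsion.\<close>

lemma finite_torsion_cyclic:
  assumes U: "subspace U"
  shows "\<exists>Y. finite Y \<and> (\<forall>v\<in>span (insert g U). \<forall>n. n \<noteq> 0 \<and> n *z v \<in> U \<longrightarrow> (\<exists>y\<in>Y. v - y \<in> U))"
proof (cases "\<exists>m>0. m *z g \<in> U")
  case True
  then obtain m where m: "m > 0" "m *z g \<in> U" by blast
  have "\<exists>y\<in>(\<lambda>k. k *z g) ` {0..<m}. v - y \<in> U" if v: "v \<in> span (insert g U)" for v
  proof -
    obtain k where k: "v - k *z g \<in> U"
      using v U by (auto simp: span_insert span_eq_iff[THEN iffD2])
    have "v - k *z g + (k div m) *z (m *z g) \<in> U"
      by (intro subspace_add[OF U] subspace_scale[OF U] m(2) k)
    moreover have "k *z g = (k div m) *z (m *z g) + (k mod m) *z g"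
      by (simp flip: scale_left_distrib)
    ultimately have "v - (k mod m) *z g \<in> U"
      by (simp add: algebra_simps)
    then show ?thesis using m by auto
  qed
  then show ?thesis by (intro exI[of _ "(\<lambda>k. k *z g) ` {0..<m}"]) auto
next
  case False
  have ne: "m *z g \<notin> U" if "m \<noteq> 0" for m
  proof (cases "m > 0")
    case True
    with False show ?thesis by blast
  next
    case m: False
    show ?thesis
    proof
      assume "m *z g \<in> U"
      then have "- (m *z g) \<in> U" by (rule subspace_neg[OF U])
      then have "(- m) *z g \<in> U" by (simp only: scale_minus_left)
      then show False using False m that by (metis neg_0_less_iff_less linorder_neqE)
    qed
  qed
  have "v \<in> U" if v: "v \<in> span (insert g U)" and n: "n \<noteq> 0" "n *z v \<in> U" for v n
  proof -
    obtain k where k: "v - k *z g \<in> U"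
      using v U by (auto simp: span_insert span_eq_iff[THEN iffD2])
    have "n *z v - n *z (v - k *z g) \<in> U"
      by (intro subspace_diff subspace_scale U k n)
    then have "(n * k) *z g \<in> U" by (simp add: algebra_simps)
    then have "n * k = 0" using ne by blast
    then have "k = 0" using n by simp
    then show ?thesis using k by simp
  qed
  then show ?thesis by (intro exI[of _ "{0}"]) auto
qed

text \<open>Generators are absorbed into \<open>U\<close> one at a time: torsion modulo
  \<open>U\<close> is torsion modulo the larger \<open>U'\<close>, and what remains lies in the
  cyclic extension of \<open>U\<close> by \<open>g\<close>.\<close>

lemma finite_torsion:
  assumes "finite T" and "subspace U"
  shows "\<exists>Y. finite Y \<and> (\<forall>v\<in>span (T \<union> U). \<forall>n. n \<noteq> 0 \<and> n *z v \<in> U \<longrightarrow> (\<exists>y\<in>Y. v - y \<in> U))"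
  using assms
proof (induction T arbitrary: U rule: finite_induct)
  case empty
  then show ?case by (intro exI[of _ "{0}"]) (auto simp: span_eq_iff[THEN iffD2])
next
  case (insert g T)
  define U' where "U' = span (insert g U)"
  have UU': "U \<subseteq> U'" by (auto simp: U'_def intro: span_base)
  have span_eq: "span (insert g T \<union> U) = span (T \<union> U')"
  proof (rule antisym)
    show "span (insert g T \<union> U) \<subseteq> span (T \<union> U')"
      by (rule span_mono) (auto simp: U'_def intro: span_base)
    have "U' \<subseteq> span (insert g T \<union> U)"
      unfolding U'_def by (rule span_mono) auto
    then show "span (T \<union> U') \<subseteq> span (insert g T \<union> U)"
      by (intro span_minimal) (auto intro: span_base)
  qed
  obtain Y where Y: "finite Y"
    "\<And>v n. v \<in> span (T \<union> U') \<Longrightarrow> n \<noteq> 0 \<Longrightarrow> n *z v \<in> U' \<Longrightarrow> \<exists>y\<in>Y. v - y \<in> U'"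
    using insert.IH[of U'] by (auto simp: U'_def)
  obtain Z where Z: "finite Z"
    "\<And>v n. v \<in> U' \<Longrightarrow> n \<noteq> 0 \<Longrightarrow> n *z v \<in> U \<Longrightarrow> \<exists>z\<in>Z. v - z \<in> U"
    using finite_torsion_cyclic[OF insert.prems, of g] by (auto simp: U'_def)
  \<comment> \<open>A representative \<open>y\<close> modulo \<open>U'\<close> need not be torsion
    modulo \<open>U\<close>. It is replaced by an element of its class that is, so that
    \<open>v - rep y\<close> is torsion modulo \<open>U\<close> and the cyclic case applies.\<close>
  define tor where "tor y v \<longleftrightarrow> v - y \<in> U' \<and> (\<exists>n. n \<noteq> 0 \<and> n *z v \<in> U)" for y v
  define rep where "rep y = (SOME v. tor y v)" for y
  have "\<exists>y\<in>(\<lambda>(y, z). rep y + z) ` (Y \<times> Z). v - y \<in> U"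
    if v: "v \<in> span (insert g T \<union> U)" and n: "n \<noteq> 0" "n *z v \<in> U" for v n
  proof -
    obtain y where y: "y \<in> Y" "v - y \<in> U'"
      using Y(2)[of v n] v n UU' span_eq by blast
    have "tor y v" using y n by (auto simp: tor_def)
    then have "tor y (rep y)" unfolding rep_def by (rule someI)
    then obtain n' where n': "rep y - y \<in> U'" "n' \<noteq> 0" "n' *z rep y \<in> U"
      by (auto simp: tor_def)
    have "(v - y) - (rep y - y) \<in> U'"
      using y(2) n'(1) unfolding U'_def by (rule span_diff)
    then have 1: "v - rep y \<in> U'" by simp
    have "n' *z (n *z v) - n *z (n' *z rep y) \<in> U"
      by (intro subspace_diff subspace_scale insert.prems n n')
    then have "(n * n') *z (v - rep y) \<in> U" by (simp add: algebra_simps)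
    then obtain z where "z \<in> Z" "v - rep y - z \<in> U"
      using Z(2)[OF 1, of "n * n'"] n n' by auto
    then show ?thesis using y by (auto simp: diff_diff_eq intro!: bexI[of _ "(y, z)"])
  qed
  then show ?case
    using Y(1) Z(1) by (intro exI[of _ "(\<lambda>(y, z). rep y + z) ` (Y \<times> Z)"]) auto
qed

lemma finite_span_mod:
  assumes "finite T" and n: "n > 0"
  shows "\<exists>Y. finite Y \<and> (\<forall>v\<in>span T. \<exists>y\<in>Y. \<exists>w. v = y + n *z w)"
  using assms(1)
proof (induction T rule: finite_induct)
  case empty
  then show ?case by (intro exI[of _ "{0}"]) (auto intro: exI[of _ 0])
next
  case (insert g T)
  then obtain Y where Y: "finite Y" "\<And>v. v \<in> span T \<Longrightarrow> \<exists>y\<in>Y. \<exists>w. v = y + n *z w"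
    by blast
  have "\<exists>y\<in>(\<lambda>(y, k). y + k *z g) ` (Y \<times> {0..<n}). \<exists>w. v = y + n *z w"
    if v: "v \<in> span (insert g T)" for v
  proof -
    obtain k where "v - k *z g \<in> span T"
      using v by (auto simp: span_insert)
    then obtain y w where yw: "y \<in> Y" "v - k *z g = y + n *z w"
      using Y(2) by blast
    have "k *z g = n *z ((k div n) *z g) + (k mod n) *z g"
      by (simp flip: scale_left_distrib)
    then have "v = (y + (k mod n) *z g) + n *z (w + (k div n) *z g)"
      using yw(2) by (simp add: algebra_simps)
    then show ?thesis using yw(1) n
      by (intro bexI[of _ "y + (k mod n) *z g"]) (auto intro!: image_eqI[of _ _ "(y, k mod n)"])
  qed
  then show ?case
    using Y(1) by (intro exI[of _ "(\<lambda>(y, k). y + k *z g) ` (Y \<times> {0..<n})"]) auto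
qed

end

section \<open>Modules over Laurent polynomials\<close>

abbreviation \<tau> :: "int poly" where "\<tau> \<equiv> [:0, 1:]"

text \<open>The module meant is the whole type modulo \<open>R\<close>, with \<open>[:0, 1:]\<close>
  acting as \<open>t\<close>. Invertibility of \<open>t\<close> is split into
  \<open>R_cancel\<close> (injective) and \<open>shift_surj\<close> (surjective); generation over
  Laurent polynomials becomes generation up to a power of \<open>t\<close>.\<close>

locale laurent_module = Modules.module scale
  for scale :: "int poly \<Rightarrow> 'm::ab_group_add \<Rightarrow> 'm" (infixr "*s" 75) +
  fixes S R :: "'m set"
  assumes finite_S: "finite S" and subspace_R: "subspace R"
    and R_cancel: "[:0, 1:] *s v \<in> R \<Longrightarrow> v \<in> R"
    and generated: "\<exists>N. [:0, 1:] ^ N *s v \<in> span (S \<union> R)"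
    and shift_surj: "\<exists>w. v - [:0, 1:] *s w \<in> R"
    and shift_minus_one_surj: "\<exists>w. v - [:-1, 1:] *s w \<in> R"
begin

sublocale Z: int_module "\<lambda>n v. [:n:] *s v"
proof
  show "[:a:] *s (x + y) = [:a:] *s x + [:a:] *s y" for a x y
    by (rule scale_right_distrib)
  show "[:a + b:] *s x = [:a:] *s x + [:b:] *s x" for a b x
    by (simp flip: scale_left_distrib)
  show "[:a:] *s [:b:] *s x = [:a * b:] *s x" for a b x
    by (simp add: mult.commute)
  show "[:1:] *s x = x" for x
    by (simp flip: one_pCons)
qed

lemma scale_pCons: "pCons a p *s v = [:a:] *s v + \<tau> *s (p *s v)"
  by (simp flip: scale_left_distrib)

section \<open>Submodules stable under t and its inverse\<close>

lemma subspace_shiftI: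
  assumes "Z.subspace V" and \<tau>: "\<And>v. v \<in> V \<Longrightarrow> \<tau> *s v \<in> V"
  shows "subspace V"
proof (rule subspaceI)
  show "p *s v \<in> V" if v: "v \<in> V" for p v
  proof (induction p)
    case (pCons a p)
    then show ?case
      unfolding scale_pCons[of a p] using assms v by (intro Z.subspace_add Z.subspace_scale \<tau>)
  qed (use assms in \<open>auto intro: Z.subspace_0\<close>)
qed (use assms in \<open>auto intro: Z.subspace_0 Z.subspace_add\<close>)

lemma subspace_Z: "subspace V \<Longrightarrow> Z.subspace V"
  by (auto simp: subspace_def Z.subspace_def)

text \<open>These are the preimages of the Laurent submodules of the module modulo \<open>R\<close>;
  closure under division by \<open>\<tau>\<close> encodes the action of \<open>1/t\<close>.\<close>

definition laurent_sub :: "'m set \<Rightarrow> bool" where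
  "laurent_sub U \<longleftrightarrow> subspace U \<and> R \<subseteq> U \<and> (\<forall>v. \<tau> *s v \<in> U \<longrightarrow> v \<in> U)"

lemma laurent_sub_R: "laurent_sub R"
  using subspace_R R_cancel by (auto simp: laurent_sub_def)

lemma laurent_sub_power:
  assumes "laurent_sub U" "\<tau> ^ N *s v \<in> U"
  shows "v \<in> U"
  using assms(2)
proof (induction N)
  case (Suc N)
  then have "\<tau> *s (\<tau> ^ N *s v) \<in> U" by simp
  then show ?case using assms(1) Suc by (auto simp: laurent_sub_def)
qed simp

lemma laurent_sub_UNIV:
  assumes U: "laurent_sub U" and "S \<subseteq> U"
  shows "v \<in> U"
proof -
  obtain N where "\<tau> ^ N *s v \<in> span (S \<union> R)"
    using generated by blast
  moreover have "span (S \<union> R) \<subseteq> U"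
    using assms by (intro span_minimal) (auto simp: laurent_sub_def)
  ultimately show ?thesis
    using U laurent_sub_power by blast
qed

lemma laurent_sub_vimage:
  assumes U: "laurent_sub U"
  shows "laurent_sub {v. p *s v \<in> U}"
proof -
  have *: "v \<in> U" if "\<tau> *s v \<in> U" for v
    using U that by (auto simp: laurent_sub_def)
  have "subspace U" "R \<subseteq> U" using U by (auto simp: laurent_sub_def)
  moreover have "p *s v \<in> R" if "v \<in> R" for v
    using subspace_R that by (rule subspace_scale)
  moreover have "p *s v \<in> U" if "p *s \<tau> *s v \<in> U" for v
    using * that by (metis scale_left_commute)
  ultimately show ?thesis
    unfolding laurent_sub_def
    by (auto simp: subspace_def scale_right_distrib scale_left_commute[of p] simp del: scale_scale)
qed

text \<open>This is \<open>U + p M\<close>. To divide by \<open>\<tau>\<close>, the element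
  \<open>w\<close> in \<open>\<tau> *s v - p *s w\<close> is itself written as a multiple of
  \<open>\<tau>\<close> modulo \<open>R\<close>, and then \<open>\<tau>\<close> cancels from the
  whole expression.\<close>

lemma laurent_sub_add_multiples:
  assumes U: "laurent_sub U"
  shows "laurent_sub {v. \<exists>w. v - p *s w \<in> U}"
  unfolding laurent_sub_def
proof (intro conjI allI impI)
  have sU: "subspace U" and RU: "R \<subseteq> U" using U by (auto simp: laurent_sub_def)
  show "subspace {v. \<exists>w. v - p *s w \<in> U}"
  proof (rule subspaceI; clarsimp)
    show "\<exists>w. - (p *s w) \<in> U" using sU by (intro exI[of _ 0]) (simp add: subspace_0)
    show "\<exists>w. x + y - p *s w \<in> U" if "x - p *s wx \<in> U" "y - p *s wy \<in> U" for x y wx wy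
      using subspace_add[OF sU that] by (intro exI[of _ "wx + wy"]) (simp add: algebra_simps)
    show "\<exists>w. c *s x - p *s w \<in> U" if "x - p *s w \<in> U" for c x w
      using subspace_scale[OF sU that, of c]
      by (intro exI[of _ "c *s w"]) (simp add: algebra_simps)
  qed
  show "R \<subseteq> {v. \<exists>w. v - p *s w \<in> U}"
    using RU by (auto intro!: exI[of _ 0])
  show "v \<in> {v. \<exists>w. v - p *s w \<in> U}" if v: "\<tau> *s v \<in> {v. \<exists>w. v - p *s w \<in> U}" for v
  proof -
    obtain w where w: "\<tau> *s v - p *s w \<in> U" using v by blast
    obtain w' where "w - \<tau> *s w' \<in> R" using shift_surj by blast
    then have "\<tau> *s v - p *s w + p *s (w - \<tau> *s w') \<in> U"
      using w RU by (intro subspace_add[OF sU] subspace_scale[OF sU]) auto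
    then have "\<tau> *s (v - p *s w') \<in> U" by (simp add: algebra_simps)
    then show ?thesis using U by (auto simp: laurent_sub_def)
  qed
qed

text \<open>Each generator is \<open>t - 1\<close> times some element modulo \<open>R\<close>.
  Nakayama with \<open>q = t - 1\<close> gives an annihilator that is a power of
  \<open>\<tau>\<close> plus a multiple of \<open>t - 1\<close>, so its value at \<open>1\<close> is
  \<open>1\<close>.\<close>

lemma annihilator_at_one: "\<exists>D. poly D 1 = 1 \<and> (\<forall>v. D *s v \<in> R)"
proof -
  have "\<exists>w N. g - [:-1, 1:] *s w \<in> R \<and> \<tau> ^ N *s w \<in> span (S \<union> R)" for g
    using generated shift_minus_one_surj by blast
  then obtain w N where w: "\<And>g. g - [:-1, 1:] *s w g \<in> R"
      and N: "\<And>g. \<tau> ^ N g *s w g \<in> span (S \<union> R)"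
    by metis
  \<comment> \<open>A common exponent for all generators, as the sum dominates every
    \<open>N g\<close>.\<close>
  define K where "K = sum N S"
  have "\<exists>u\<in>span S. \<tau> ^ K *s g - [:-1, 1:] *s u \<in> R" if g: "g \<in> S" for g
  proof -
    have "K = N g + (K - N g)"
      using g finite_S by (simp add: K_def member_le_sum)
    then have "\<tau> ^ K *s w g = \<tau> ^ (K - N g) *s (\<tau> ^ N g *s w g)"
      by (metis power_add scale_scale mult.commute)
    also have "\<dots> \<in> span (S \<union> R)"
      using N by (rule span_scale)
    finally obtain u z where uz: "\<tau> ^ K *s w g = u + z" "u \<in> span S" "z \<in> R"
      using subspace_R by (auto simp: span_Un span_eq_iff[THEN iffD2])
    have "\<tau> ^ K *s g - [:-1, 1:] *s u = \<tau> ^ K *s (g - [:-1, 1:] *s w g) + [:-1, 1:] *s z"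
      using uz(1) by (simp add: scale_right_diff_distrib scale_right_distrib scale_left_commute[of "\<tau> ^ K"]
          del: scale_scale mult_pCons_left mult_pCons_right)
    also have "\<dots> \<in> R"
      by (intro subspace_add[OF subspace_R] subspace_scale[OF subspace_R] w uz)
    finally show ?thesis using uz by blast
  qed
  then obtain M h where M: "\<And>g. g \<in> S \<Longrightarrow> ((\<tau> ^ K) ^ M + [:-1, 1:] * h) *s g \<in> R"
    using nakayama[OF finite_S subspace_R] by meson
  define D where "D = (\<tau> ^ K) ^ M + [:-1, 1:] * h"
  have "poly D 1 = 1" by (simp add: D_def)
  moreover have "D *s v \<in> R" for v
    using laurent_sub_UNIV[OF laurent_sub_vimage[OF laurent_sub_R, of D], of v] M by (auto simp: D_def)
  ultimately show ?thesis by blast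
qed

text \<open>Once \<open>e\<close> is inverted, \<open>T\<close> spans everything modulo
  \<open>U\<close> over the integers: the leading coefficient of \<open>q\<close> reduces powers of
  \<open>\<tau>\<close> above the degree, the constant coefficient reduces negative powers. So the
  elements with some multiple by \<open>e ^ k\<close> in \<open>W\<close> are stable under
  \<open>t\<close> and \<open>1/t\<close>, and they contain \<open>S\<close>.\<close>

lemma integral_span:
  assumes U: "laurent_sub U" and q: "\<And>v. q *s v \<in> U"
  defines "T \<equiv> (\<lambda>(i, g). \<tau> ^ i *s g) ` ({..Polynomial.degree q} \<times> S)"
    and "e \<equiv> Polynomial.lead_coeff q * poly.coeff q 0"
  shows "\<exists>k. [:e ^ k:] *s v \<in> Z.span (T \<union> U)"
proof -
  have sU: "subspace U" and RU: "R \<subseteq> U" using U by (auto simp: laurent_sub_def)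
  define W where "W = Z.span (T \<union> U)"
  have W_add: "x + y \<in> W" if "x \<in> W" "y \<in> W" for x y using that by (auto simp: W_def Z.span_add)
  have W_diff: "x - y \<in> W" if "x \<in> W" "y \<in> W" for x y using that by (auto simp: W_def Z.span_diff)
  have W_scale: "[:n:] *s x \<in> W" if "x \<in> W" for n x using that by (auto simp: W_def Z.span_scale)
  have W_U: "x \<in> W" if "x \<in> U" for x using that by (auto simp: W_def Z.span_base)
  have low: "p *s g \<in> W" if g: "g \<in> S" and p: "Polynomial.degree p \<le> Polynomial.degree q" for p g
  proof -
    have "p = (\<Sum>i\<le>Polynomial.degree p. [:poly.coeff p i:] * \<tau> ^ i)"
      using poly_as_sum_of_monoms[of p] by (simp add: monom_altdef)
    then have "p *s g = (\<Sum>i\<le>Polynomial.degree p. [:poly.coeff p i:] *s \<tau> ^ i *s g)"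
      unfolding scale_scale by (metis scale_sum_left)
    also have "\<dots> \<in> W"
      unfolding W_def
      by (intro Z.span_sum Z.span_scale Z.span_base) (use g p in \<open>auto simp: T_def\<close>)
    finally show ?thesis .
  qed
  define c d where "c = Polynomial.lead_coeff q" and "d = poly.coeff q 0"
  have up: "[:c:] *s \<tau> *s w \<in> W" if "w \<in> W" for w
    using that unfolding W_def
  proof (induction w rule: Z.span_induct)
    case base
    show ?case unfolding W_def[symmetric]
    proof (rule Z.subspaceI; unfold mem_Collect_eq)
      show "[:c:] *s \<tau> *s 0 \<in> W" by (simp add: W_U subspace_0[OF sU])
      show "[:c:] *s \<tau> *s (x + y) \<in> W" if "[:c:] *s \<tau> *s x \<in> W" "[:c:] *s \<tau> *s y \<in> W" for x y
        unfolding scale_right_distrib by (rule W_add[OF that])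
      show "[:c:] *s \<tau> *s [:n:] *s x \<in> W" if "[:c:] *s \<tau> *s x \<in> W" for n x
        using W_scale[OF that, of n] by (metis scale_left_commute)
    qed
  next
    case (step w)
    show ?case unfolding W_def[symmetric]
    proof (cases "w \<in> U")
      case False
      with step obtain i g where i: "i \<le> Polynomial.degree q" and g: "g \<in> S" and w: "w = \<tau> ^ i *s g"
        by (auto simp: T_def)
      show "[:c:] *s \<tau> *s w \<in> W"
      proof (cases "i < Polynomial.degree q")
        case True
        have "\<tau> *s w = \<tau> ^ Suc i *s g" by (simp add: w)
        also have "\<dots> \<in> W"
          by (rule low[OF g]) (use True in \<open>simp add: degree_power_eq del: power_Suc\<close>)
        finally show ?thesis by (rule W_scale)
      next
        case False
        then have i: "i = Polynomial.degree q" using i by simp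
        \<comment> \<open>Without its leading term, \<open>q\<close> can be multiplied by
          \<open>\<tau>\<close> and stay within the range of degrees covered by
          \<open>low\<close>.\<close>
        define q' where "q' = q - Polynomial.monom c (Polynomial.degree q)"
        have "Polynomial.degree (\<tau> * q') \<le> Polynomial.degree q"
        proof (cases "q' = 0")
          case False
          have "Polynomial.degree q' \<le> Polynomial.degree q"
            unfolding q'_def by (intro degree_diff_le degree_monom_le) simp
          moreover have "poly.coeff q' (Polynomial.degree q) = 0" by (simp add: q'_def c_def)
          ultimately have "Polynomial.degree q' < Polynomial.degree q"
            using False by (metis eq_zero_or_degree_less)
          then show ?thesis by (simp add: degree_pCons_eq_if)
        qed simp
        then have "(\<tau> * q') *s g \<in> W" by (intro low g)
        moreover have "[:c:] *s \<tau> *s w = \<tau> *s (q *s g) - (\<tau> * q') *s g"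
        proof -
          have "[:c:] * (\<tau> * \<tau> ^ Polynomial.degree q) = \<tau> * q - \<tau> * q'"
            by (simp add: q'_def monom_altdef algebra_simps)
          then show ?thesis
            unfolding w i by (metis scale_scale scale_left_diff_distrib)
        qed
        ultimately show ?thesis
          using W_diff W_U q subspace_scale[OF sU] by presburger
      qed
    qed (use sU in \<open>auto intro!: W_U subspace_scale\<close>)
  qed
  \<comment> \<open>Division by \<open>t\<close> up to the factor \<open>d\<close>: a positive power
    of \<open>\<tau>\<close> loses one factor, and for the zeroth power
    \<open>q = d + \<tau> q'\<close> gives \<open>d g = - \<tau> q' g\<close> modulo
    \<open>U\<close>.\<close>
  have down: "\<exists>w'\<in>W. [:d:] *s w - \<tau> *s w' \<in> U" if "w \<in> W" for w
    using that unfolding W_def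
  proof (induction w rule: Z.span_induct)
    case base
    show ?case unfolding W_def[symmetric]
    proof (rule Z.subspaceI; unfold mem_Collect_eq)
      show "\<exists>w'\<in>W. [:d:] *s 0 - \<tau> *s w' \<in> U"
        by (intro bexI[of _ 0]) (auto simp: W_U subspace_0[OF sU])
      show "\<exists>w'\<in>W. [:d:] *s (x + y) - \<tau> *s w' \<in> U"
        if xy: "\<exists>w'\<in>W. [:d:] *s x - \<tau> *s w' \<in> U" "\<exists>w'\<in>W. [:d:] *s y - \<tau> *s w' \<in> U" for x y
      proof -
        obtain x' y' where x'y': "x' \<in> W" "[:d:] *s x - \<tau> *s x' \<in> U"
            "y' \<in> W" "[:d:] *s y - \<tau> *s y' \<in> U"
          using xy by blast
        show ?thesis
          using subspace_add[OF sU x'y'(2,4)] x'y'(1,3)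
          by (intro bexI[of _ "x' + y'"]) (auto simp: algebra_simps W_add)
      qed
      show "\<exists>w'\<in>W. [:d:] *s [:n:] *s x - \<tau> *s w' \<in> U"
        if x: "\<exists>w'\<in>W. [:d:] *s x - \<tau> *s w' \<in> U" for x n
      proof -
        obtain x' where x': "x' \<in> W" "[:d:] *s x - \<tau> *s x' \<in> U"
          using x by blast
        show ?thesis
          using subspace_scale[OF sU x'(2), of "[:n:]"] x'(1)
          by (intro bexI[of _ "[:n:] *s x'"]) (auto simp: algebra_simps W_scale)
      qed
    qed
  next
    case (step w)
    show ?case unfolding W_def[symmetric]
    proof (cases "w \<in> U")
      case False
      with step obtain i g where i: "i \<le> Polynomial.degree q" and g: "g \<in> S" and w: "w = \<tau> ^ i *s g"
        by (auto simp: T_def)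
      show "\<exists>w'\<in>W. [:d:] *s w - \<tau> *s w' \<in> U"
      proof (cases i)
        case 0
        obtain q' where q': "q = pCons d q'"
          by (cases q) (auto simp: d_def)
        have "q *s g \<in> U" by (rule q)
        then have "[:d:] *s w - \<tau> *s - (q' *s g) \<in> U"
          by (simp only: q' scale_pCons[of d q'] w 0) simp
        moreover have "Polynomial.degree q' \<le> Polynomial.degree q" by (simp add: q' degree_pCons_eq_if)
        ultimately show ?thesis
          using low[OF g, of q'] W_scale[of "q' *s g" "-1"]
          by (intro bexI[of _ "- (q' *s g)"]) (auto simp flip: one_pCons)
      next
        case (Suc j)
        have "\<tau> ^ j *s g \<in> W" using i Suc by (intro low[OF g]) (simp add: degree_power_eq)
        then have "[:d:] *s \<tau> ^ j *s g \<in> W" by (rule W_scale)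
        then show ?thesis
          by (rule bexI[rotated]) (simp add: w Suc subspace_0[OF sU] algebra_simps)
      qed
    next
      case True
      then show "\<exists>w'\<in>W. [:d:] *s w - \<tau> *s w' \<in> U"
        by (intro bexI[of _ 0]) (auto simp: W_U subspace_0[OF sU] subspace_scale[OF sU])
    qed
  qed
  define V where "V = {v. \<exists>k. [:e ^ k:] *s v \<in> W}"
  have e: "[:e ^ Suc k:] *s v = [:d:] *s [:c:] *s [:e ^ k:] *s v" for k v
    by (simp add: e_def c_def d_def algebra_simps)
  have "Z.subspace V"
  proof (rule Z.subspaceI)
    show "0 \<in> V" by (auto simp: V_def intro: W_U subspace_0[OF sU])
    show "[:n:] *s x \<in> V" if x: "x \<in> V" for n x
    proof -
      obtain k where "[:e ^ k:] *s x \<in> W" using x by (auto simp: V_def)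
      from W_scale[OF this, of n] have "[:e ^ k:] *s [:n:] *s x \<in> W"
        by (simp add: algebra_simps)
      then show ?thesis by (auto simp: V_def)
    qed
    show "x + y \<in> V" if xy: "x \<in> V" "y \<in> V" for x y
    proof -
      obtain k l where kl: "[:e ^ k:] *s x \<in> W" "[:e ^ l:] *s y \<in> W" using xy by (auto simp: V_def)
      have "[:e ^ l:] *s [:e ^ k:] *s x + [:e ^ k:] *s [:e ^ l:] *s y \<in> W"
        by (rule W_add[OF W_scale[OF kl(1)] W_scale[OF kl(2)]])
      then have "[:e ^ (k + l):] *s (x + y) \<in> W"
        by (simp add: algebra_simps power_add)
      then show ?thesis unfolding V_def by blast
    qed
  qed
  moreover have "\<tau> *s v \<in> V" if v: "v \<in> V" for v
  proof -
    obtain k where "[:e ^ k:] *s v \<in> W" using v by (auto simp: V_def)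
    from W_scale[OF up[OF this], of d]
    have "[:e ^ Suc k:] *s \<tau> *s v \<in> W"
      by (simp add: e_def c_def d_def algebra_simps)
    then show ?thesis unfolding V_def by blast
  qed
  moreover have "v \<in> V" if v: "\<tau> *s v \<in> V" for v
  proof -
    obtain k where "[:e ^ k:] *s \<tau> *s v \<in> W" using v by (auto simp: V_def)
    then obtain w' where w': "w' \<in> W" "[:d:] *s [:e ^ k:] *s \<tau> *s v - \<tau> *s w' \<in> U"
      using down by blast
    then have "\<tau> *s ([:d:] *s [:e ^ k:] *s v - w') \<in> U"
      by (simp add: algebra_simps)
    then have "[:d:] *s [:e ^ k:] *s v - w' \<in> U"
      using U by (auto simp: laurent_sub_def)
    then have "[:d:] *s [:e ^ k:] *s v - w' + w' \<in> W"
      by (rule W_add[OF W_U w'(1)])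
    then have "[:c:] *s [:d:] *s [:e ^ k:] *s v \<in> W"
      unfolding diff_add_cancel by (rule W_scale)
    then have "[:e ^ Suc k:] *s v \<in> W"
      by (simp add: e_def c_def d_def algebra_simps)
    then show ?thesis unfolding V_def by blast
  qed
  moreover have "R \<subseteq> V"
    using RU W_U by (auto simp: V_def intro!: exI[of _ 0] simp flip: one_pCons)
  ultimately have "laurent_sub V"
    unfolding laurent_sub_def by (blast intro: subspace_shiftI)
  moreover have "S \<subseteq> V"
    using low[of _ 1] by (auto simp: V_def intro!: exI[of _ 0] simp flip: one_pCons)
  ultimately have "v \<in> V"
    by (rule laurent_sub_UNIV)
  then show ?thesis by (auto simp: V_def W_def)
qed

text \<open>\<open>p\<close> may divide the extreme coefficients of \<open>D\<close>, and such
  primes matter because \<open>finite_mod\<close> is needed for all \<open>n\<close>. So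
  \<open>D\<close> is replaced by an annihilator \<open>q\<close> modulo \<open>U + p M\<close>, of
  least degree among those nonzero modulo \<open>p\<close>; minimality makes its extreme
  coefficients prime to \<open>p\<close>.\<close>

lemma finite_mod_prime:
  assumes U: "laurent_sub U" and p: "Factorial_Ring.prime (p::int)"
  shows "\<exists>Y. finite Y \<and> (\<forall>v. \<exists>y\<in>Y. \<exists>w. v - y - [:p:] *s w \<in> U)"
proof -
  define U' where "U' = {v. \<exists>w. v - [:p:] *s w \<in> U}"
  have U': "laurent_sub U'"
    unfolding U'_def by (rule laurent_sub_add_multiples[OF U])
  have sU: "subspace U" and RU: "R \<subseteq> U" using U by (auto simp: laurent_sub_def)
  have sU': "subspace U'" and RU': "R \<subseteq> U'" and can: "\<And>v. \<tau> *s v \<in> U' \<Longrightarrow> v \<in> U'"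
    using U' by (auto simp: laurent_sub_def)
  have pU': "[:p:] *s v \<in> U'" for v
    by (auto simp: U'_def subspace_0[OF sU] intro: exI[of _ v])
  define P where "P q \<longleftrightarrow> \<not> [:p:] dvd q \<and> (\<forall>v. q *s v \<in> U')" for q
  obtain D where D: "poly D 1 = 1" "\<And>v. D *s v \<in> R"
    using annihilator_at_one by blast
  \<comment> \<open>The value \<open>1\<close> at \<open>1\<close> ensures that some annihilator
    survives modulo \<open>p\<close>.\<close>
  have "\<not> [:p:] dvd D"
  proof
    assume "[:p:] dvd D"
    then have "p dvd poly D 1" by (auto simp: dvd_def)
    then show False using D p not_prime_unit by auto
  qed
  then have "P D" using D RU' by (auto simp: P_def)
  then obtain q where q: "P q" "\<And>q'. P q' \<Longrightarrow> Polynomial.degree q \<le> Polynomial.degree q'"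
    by (metis ex_has_least_nat)
  \<comment> \<open>Otherwise the constant term acts as zero modulo \<open>U'\<close> and
    \<open>\<tau>\<close> cancels from the rest, leaving an annihilator of smaller degree. Likewise,
    a leading term divisible by \<open>p\<close> could be deleted.\<close>
  have "\<not> p dvd poly.coeff q 0"
  proof
    assume dv: "p dvd poly.coeff q 0"
    obtain a q' where q': "q = pCons a q'" by (cases q)
    obtain b where b: "a = p * b" using dv q' by auto
    have "q' *s v \<in> U'" for v
    proof (rule can)
      have "q *s v = [:p:] *s [:b:] *s v + \<tau> *s q' *s v"
        using scale_pCons[of a q' v] unfolding q' b by (simp add: mult.commute)
      then have "\<tau> *s q' *s v = q *s v - [:p:] *s [:b:] *s v"
        by simp
      also have "\<dots> \<in> U'"
        using q(1) by (intro subspace_diff[OF sU'] pU') (auto simp: P_def)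
      finally show "\<tau> *s q' *s v \<in> U'" .
    qed
    moreover have "\<not> [:p:] dvd q'"
    proof -
      obtain n where n: "\<not> p dvd poly.coeff q n" using q(1) by (auto simp: P_def const_poly_dvd_iff)
      with dv obtain m where "n = Suc m" by (cases n) auto
      then show ?thesis using n by (auto simp: q' const_poly_dvd_iff)
    qed
    ultimately have "Polynomial.degree q \<le> Polynomial.degree q'" using q(2) by (simp add: P_def)
    then show False using \<open>\<not> [:p:] dvd q'\<close> q' by (auto simp: degree_pCons_eq_if split: if_splits)
  qed
  moreover have "\<not> p dvd Polynomial.lead_coeff q"
  proof
    assume dv: "p dvd Polynomial.lead_coeff q"
    define m where "m = Polynomial.monom (Polynomial.lead_coeff q) (Polynomial.degree q)"
    obtain b where b: "Polynomial.lead_coeff q = p * b" using dv by auto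
    have m: "m = [:p:] * Polynomial.monom b (Polynomial.degree q)"
      unfolding m_def b by (simp add: smult_monom)
    have "(q - m) *s v \<in> U'" for v
      unfolding scale_left_diff_distrib m scale_scale[symmetric]
      using q(1) by (intro subspace_diff[OF sU'] pU') (auto simp: P_def)
    moreover have "\<not> [:p:] dvd q - m"
    proof
      assume "[:p:] dvd q - m"
      moreover have "[:p:] dvd m" unfolding m by (rule dvd_triv_left)
      ultimately have "[:p:] dvd (q - m) + m" by (rule dvd_add)
      then show False using q(1) by (simp add: P_def)
    qed
    ultimately have "P (q - m)" by (auto simp: P_def)
    then have "Polynomial.degree q \<le> Polynomial.degree (q - m)" by (rule q(2))
    moreover have "q - m \<noteq> 0" using \<open>\<not> [:p:] dvd q - m\<close> by auto
    moreover have "Polynomial.degree (q - m) \<le> Polynomial.degree q"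
      unfolding m_def by (intro degree_diff_le degree_monom_le) simp
    moreover have "poly.coeff (q - m) (Polynomial.degree q) = 0"
      by (simp add: m_def)
    ultimately show False
      by (metis eq_zero_or_degree_less not_less)
  qed
  ultimately have e: "coprime (Polynomial.lead_coeff q * poly.coeff q 0) p"
    using p by (simp add: prime_dvd_mult_iff prime_imp_coprime coprime_commute)
  define T where "T = (\<lambda>(i, g). \<tau> ^ i *s g) ` ({..Polynomial.degree q} \<times> S)"
  have T: "finite T" unfolding T_def using finite_S by simp
  \<comment> \<open>By Bezout the denominators left by \<open>integral_span\<close> are invertible
    modulo \<open>p\<close>, and multiples of \<open>p\<close> already lie in
    \<open>U'\<close>.\<close>
  have in_span: "v \<in> Z.span (T \<union> U')" for v
  proof -
    obtain k where k: "[:(Polynomial.lead_coeff q * poly.coeff q 0) ^ k:] *s v \<in> Z.span (T \<union> U')"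
      using integral_span[OF U', of q v] q(1) by (auto simp: P_def T_def)
    have "coprime ((Polynomial.lead_coeff q * poly.coeff q 0) ^ k) p" using e by simp
    then obtain a b where ab: "a * (Polynomial.lead_coeff q * poly.coeff q 0) ^ k + b * p = 1"
      using bezout_int[of "(Polynomial.lead_coeff q * poly.coeff q 0) ^ k" p] by auto
    have "v = [:a * (Polynomial.lead_coeff q * poly.coeff q 0) ^ k + b * p:] *s v"
      unfolding ab by (simp flip: one_pCons)
    also have "\<dots> = [:a:] *s [:(Polynomial.lead_coeff q * poly.coeff q 0) ^ k:] *s v + [:p:] *s [:b:] *s v"
      by (simp add: mult.commute flip: scale_left_distrib)
    also have "\<dots> \<in> Z.span (T \<union> U')"
      by (intro Z.span_add Z.span_scale[OF k] Z.span_base UnI2 pU')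
    finally show ?thesis .
  qed
  obtain Y where Y: "finite Y" "\<And>v. v \<in> Z.span T \<Longrightarrow> \<exists>y\<in>Y. \<exists>w. v = y + [:p:] *s w"
    using Z.finite_span_mod[OF T, of p] p prime_gt_0_int by auto
  have "\<exists>y\<in>Y. \<exists>w. v - y - [:p:] *s w \<in> U" for v
  proof -
    obtain x u where xu: "v = x + u" "x \<in> Z.span T" "u \<in> U'"
      using in_span[of v] subspace_Z[OF sU'] by (auto simp: Z.span_Un Z.span_eq_iff[THEN iffD2])
    obtain y w where y: "y \<in> Y" "x = y + [:p:] *s w" using Y(2) xu by blast
    obtain w' where "u - [:p:] *s w' \<in> U" using xu by (auto simp: U'_def)
    then have "v - y - [:p:] *s (w + w') \<in> U"
      using xu(1) y by (simp add: algebra_simps)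
    then show ?thesis using y(1) by blast
  qed
  then show ?thesis using Y(1) by blast
qed

lemma finite_mod:
  assumes U: "laurent_sub U" and "n > (0::nat)"
  shows "\<exists>Y. finite Y \<and> (\<forall>v. \<exists>y\<in>Y. \<exists>w. v - y - [:int n:] *s w \<in> U)"
  using assms(2)
proof (induction n rule: less_induct)
  case (less n)
  have sU: "subspace U" using U by (simp add: laurent_sub_def)
  show ?case
  proof (cases "n = 1")
    case True
    have "v - 0 - [:int n:] *s v \<in> U" for v
      using True by (simp add: subspace_0[OF sU] flip: one_pCons)
    then show ?thesis by (intro exI[of _ "{0}"]) blast
  next
    case False
    then obtain p where p: "Factorial_Ring.prime p" "p dvd n" by (metis prime_factor_nat)
    then obtain m where m: "n = p * m" by auto
    have "m < n" "m > 0" using m less.prems p prime_gt_1_nat by auto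
    then obtain Z where Z: "finite Z" "\<And>v. \<exists>y\<in>Z. \<exists>w. v - y - [:int m:] *s w \<in> U"
      using less.IH by blast
    obtain Y where Y: "finite Y" "\<And>v. \<exists>y\<in>Y. \<exists>w. v - y - [:int p:] *s w \<in> U"
      using finite_mod_prime[OF U, of "int p"] p by auto
    have "\<exists>y\<in>(\<lambda>(y, z). y + [:int p:] *s z) ` (Y \<times> Z). \<exists>w. v - y - [:int n:] *s w \<in> U" for v
    proof -
      obtain y w where y: "y \<in> Y" "v - y - [:int p:] *s w \<in> U" using Y(2) by blast
      obtain z w' where z: "z \<in> Z" "w - z - [:int m:] *s w' \<in> U" using Z(2) by blast
      have "v - y - [:int p:] *s w + [:int p:] *s (w - z - [:int m:] *s w') \<in> U"
        by (rule subspace_add[OF sU y(2) subspace_scale[OF sU z(2)]])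
      then have "v - (y + [:int p:] *s z) - [:int n:] *s w' \<in> U"
        by (simp add: algebra_simps m)
      then show ?thesis using y z by force
    qed
    then show ?thesis
      using Y(1) Z(1) by (intro exI[of _ "(\<lambda>(y, z). y + [:int p:] *s z) ` (Y \<times> Z)"]) auto
  qed
qed

text \<open>Pigeonhole: \<open>f j\<close> records how \<open>\<tau> ^ j\<close> moves the
  representatives in \<open>Y\<close>. Two exponents \<open>i < j\<close> give the same map, and
  \<open>\<tau> ^ i\<close> cancels because \<open>U\<close> is closed under division by
  \<open>\<tau>\<close>.\<close>

lemma finite_order:
  assumes U: "laurent_sub U" and Y: "finite Y" "\<And>v. \<exists>y\<in>Y. v - y \<in> U"
  shows "\<exists>L\<ge>1. \<forall>v. (\<tau> ^ L - 1) *s v \<in> U"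
proof -
  have sU: "subspace U" using U by (auto simp: laurent_sub_def)
  define f where "f j = restrict (\<lambda>y. SOME z. z \<in> Y \<and> \<tau> ^ j *s y - z \<in> U) Y" for j
  have f: "f j y \<in> Y \<and> \<tau> ^ j *s y - f j y \<in> U" if "y \<in> Y" for j y
    using someI_ex[of "\<lambda>z. z \<in> Y \<and> \<tau> ^ j *s y - z \<in> U"] Y(2)[of "\<tau> ^ j *s y"] that
    unfolding f_def by auto
  have "range f \<subseteq> Y \<rightarrow>\<^sub>E Y" using f by (auto simp: f_def)
  then have "finite (range f)" using Y(1) by (meson finite_PiE finite_subset)
  then have "\<not> inj f" using finite_imageD infinite_UNIV_nat by blast
  then obtain i j where "f i = f j" "i \<noteq> j" by (auto simp: inj_def)
  then obtain i j where ij: "f i = f j" "i < j" by (metis nat_neq_iff)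
  have *: "\<tau> ^ j *s v - \<tau> ^ i *s v \<in> U" for v
  proof -
    obtain y where y: "y \<in> Y" "v - y \<in> U" using Y(2) by blast
    have "(\<tau> ^ j - \<tau> ^ i) *s (v - y) + ((\<tau> ^ j *s y - f j y) - (\<tau> ^ i *s y - f i y)) \<in> U"
      using f[OF y(1)] by (intro subspace_add[OF sU subspace_scale[OF sU y(2)] subspace_diff[OF sU]]) auto
    then show ?thesis
      using ij by (simp add: algebra_simps)
  qed
  have "(\<tau> ^ (j - i) - 1) *s v \<in> U" for v
  proof (rule laurent_sub_power[OF U])
    have "\<tau> ^ i *s (\<tau> ^ (j - i) - 1) *s v = \<tau> ^ j *s v - \<tau> ^ i *s v"
      using ij by (simp add: algebra_simps flip: power_add)
    then show "\<tau> ^ i *s (\<tau> ^ (j - i) - 1) *s v \<in> U" using * by simp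
  qed
  then show ?thesis using ij by (intro exI[of _ "j - i"]) auto
qed


text \<open>Each \<open>a\<close> in \<open>T\<close> is \<open>p\<close> times some
  \<open>w a\<close> modulo \<open>U\<close>, and a power of \<open>e\<close> returns
  \<open>w a\<close> to the integer span of \<open>T\<close> and \<open>U\<close>. Nakayama over the
  integers yields an annihilator congruent to a power of \<open>e\<close> modulo \<open>p\<close>,
  hence nonzero.\<close>

lemma torsion_of_divisible:
  assumes U: "laurent_sub U" and p: "Factorial_Ring.prime (p::int)"
    and D: "\<And>v. D *s v \<in> R" "\<not> p dvd Polynomial.lead_coeff D * poly.coeff D 0"
    and divisible: "\<And>v. \<exists>w. v - [:p:] *s w \<in> U"
  shows "\<exists>n. n \<noteq> 0 \<and> (\<forall>v. [:n:] *s v \<in> U)"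
proof -
  have sU: "subspace U" and RU: "R \<subseteq> U" using U by (auto simp: laurent_sub_def)
  define T where "T = (\<lambda>(i, g). \<tau> ^ i *s g) ` ({..Polynomial.degree D} \<times> S)"
  define e where "e = Polynomial.lead_coeff D * poly.coeff D 0"
  have T: "finite T" unfolding T_def using finite_S by simp
  have "\<exists>w k. a - [:p:] *s w \<in> U \<and> [:e ^ k:] *s w \<in> Z.span (T \<union> U)" for a
  proof -
    obtain w where w: "a - [:p:] *s w \<in> U" using divisible by blast
    have "D *s v \<in> U" for v using D(1) RU by blast
    then obtain k where "[:e ^ k:] *s w \<in> Z.span (T \<union> U)"
      using integral_span[OF U, of D w] by (auto simp: T_def e_def)
    then show ?thesis using w by blast
  qed
  then obtain w k where w: "\<And>a. a - [:p:] *s w a \<in> U"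
    and k: "\<And>a. [:e ^ k a:] *s w a \<in> Z.span (T \<union> U)" by metis
  define K where "K = sum k T"
  have "\<exists>x\<in>Z.span T. [:e ^ K:] *s a - [:p:] *s x \<in> U" if a: "a \<in> T" for a
  proof -
    have "K = (K - k a) + k a" using a T by (simp add: K_def member_le_sum)
    then have "e ^ K = e ^ (K - k a) * e ^ k a" by (metis power_add)
    then have "[:e ^ K:] *s w a = [:e ^ (K - k a):] *s [:e ^ k a:] *s w a"
      by (simp add: mult.commute)
    also have "\<dots> \<in> Z.span (T \<union> U)" by (rule Z.span_scale[OF k])
    finally obtain x u where xu: "[:e ^ K:] *s w a = x + u" "x \<in> Z.span T" "u \<in> U"
      using subspace_Z[OF sU] by (auto simp: Z.span_Un Z.span_eq_iff[THEN iffD2])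
    have "[:e ^ K:] *s a - [:p:] *s x = [:e ^ K:] *s (a - [:p:] *s w a) + [:p:] *s ([:e ^ K:] *s w a - x)"
      by (simp add: algebra_simps)
    also have "\<dots> = [:e ^ K:] *s (a - [:p:] *s w a) + [:p:] *s u"
      using xu(1) by simp
    also have "\<dots> \<in> U"
      by (rule subspace_add[OF sU subspace_scale[OF sU w] subspace_scale[OF sU xu(3)]])
    finally show ?thesis using xu(2) by blast
  qed
  then obtain N h where Nh: "\<And>a. a \<in> T \<Longrightarrow> [:(e ^ K) ^ N + p * h:] *s a \<in> U"
    using Z.nakayama[OF T subspace_Z[OF sU], of "e ^ K" p] by meson
  define n where "n = (e ^ K) ^ N + p * h"
  have "n \<noteq> 0"
  proof
    assume "n = 0"
    then have "(e ^ K) ^ N = p * (- h)" by (simp add: n_def)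
    then have "p dvd (e ^ K) ^ N" by (metis dvd_triv_left)
    then have "p dvd e" using p prime_dvd_power by blast
    then show False using D(2) by (simp add: e_def)
  qed
  moreover have "S \<subseteq> {v. [:n:] *s v \<in> U}"
  proof clarify
    fix g assume "g \<in> S"
    then have "g \<in> T" unfolding T_def by (auto intro!: image_eqI[of _ _ "(0, g)"])
    then show "[:n:] *s g \<in> U" unfolding n_def by (rule Nh)
  qed
  ultimately show ?thesis
    using laurent_sub_UNIV[OF laurent_sub_vimage[OF U, of "[:n:]"]] by blast
qed

text \<open>The image of \<open>t^s - 1\<close> is a copy of the module modulo the kernel
  \<open>U\<close>. Bounded exponent makes it finite, so some power of \<open>t\<close> acts
  trivially on it, and a unipotent power of \<open>t\<close> with torsion difference from
  \<open>1\<close> has finite order.\<close>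

lemma finite_order_of_torsion:
  assumes s: "s \<ge> 1" and n: "n \<noteq> 0" and tor: "\<And>v. [:n:] *s (\<tau> ^ s - 1) *s v \<in> R"
  shows "\<exists>L\<ge>1. \<forall>v. (\<tau> ^ L - 1) *s v \<in> R"
proof -
  define m where "m = nat \<bar>n\<bar>"
  have m: "m > 0" using n by (simp add: m_def)
  have tor': "[:int m:] *s (\<tau> ^ s - 1) *s v \<in> R" for v
  proof (cases "n > 0")
    case False
    have "[:int m:] *s (\<tau> ^ s - 1) *s v = - ([:n:] *s (\<tau> ^ s - 1) *s v)"
      using False by (simp add: m_def flip: scale_minus_left)
    then show ?thesis using subspace_neg[OF subspace_R tor] by simp
  qed (use tor in \<open>simp add: m_def\<close>)
  define U where "U = {v. (\<tau> ^ s - 1) *s v \<in> R}"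
  have U: "laurent_sub U"
    unfolding U_def by (rule laurent_sub_vimage[OF laurent_sub_R])
  then have sU: "subspace U" by (simp add: laurent_sub_def)
  have mU: "[:int m:] *s v \<in> U" for v
    unfolding U_def using tor'[of v] by (simp only: mem_Collect_eq scale_left_commute[of "\<tau> ^ s - 1"])
  obtain Y where Y: "finite Y" "\<And>v. \<exists>y\<in>Y. \<exists>w. v - y - [:int m:] *s w \<in> U"
    using finite_mod[OF U m] by blast
  have "\<exists>y\<in>Y. v - y \<in> U" for v
    using Y(2)[of v] subspace_add[OF sU _ mU] by (metis diff_add_cancel)
  then obtain L where L: "L \<ge> 1" "\<And>v. (\<tau> ^ L - 1) *s v \<in> U"
    using finite_order[OF U Y(1)] by blast
  \<comment> \<open>A common power of \<open>\<tau> ^ s\<close> and \<open>\<tau> ^ L\<close>: one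
    factor \<open>y - 1\<close> maps into \<open>U\<close> through \<open>\<tau> ^ L - 1\<close>, a
    second kills \<open>U\<close> through \<open>\<tau> ^ s - 1\<close>.\<close>
  define y where "y = \<tau> ^ (s * L)"
  have dvd: "x - 1 dvd x ^ k - 1" for x :: "int poly" and k
    by (simp add: power_diff_1_eq)
  obtain a where a: "y - 1 = a * (\<tau> ^ s - 1)"
    using dvd[of "\<tau> ^ s" L] unfolding y_def power_mult by (metis dvdE mult.commute)
  obtain b where b: "y - 1 = b * (\<tau> ^ L - 1)"
    using dvd[of "\<tau> ^ L" s] unfolding y_def mult.commute[of s] power_mult by (metis dvdE mult.commute)
  have 1: "(y - 1) *s (y - 1) *s v \<in> R" for v
  proof -
    have "(y - 1) *s (y - 1) *s v = (a * b) *s (\<tau> ^ s - 1) *s (\<tau> ^ L - 1) *s v"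
      by (subst a, subst b) (simp only: scale_scale mult_ac)
    also have "\<dots> \<in> R"
      using L(2)[of v] unfolding U_def mem_Collect_eq by (rule subspace_scale[OF subspace_R])
    finally show ?thesis .
  qed
  have 2: "[:int m:] *s (y - 1) *s v \<in> R" for v
  proof -
    have "[:int m:] *s (y - 1) *s v = a *s [:int m:] *s (\<tau> ^ s - 1) *s v"
      by (subst a) (simp only: scale_scale mult_ac)
    then show ?thesis using subspace_scale[OF subspace_R tor'] by simp
  qed
  \<comment> \<open>Binomial expansion of \<open>(1 + (y - 1)) ^ k\<close>, with all terms from the
    second order on collected in \<open>z\<close>.\<close>
  have "\<exists>z. y ^ k - 1 = [:int k:] * (y - 1) + z * ((y - 1) * (y - 1))" for k
  proof (induction k)
    case (Suc k)
    then obtain z where z: "y ^ k - 1 = [:int k:] * (y - 1) + z * ((y - 1) * (y - 1))" by blast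
    have "y ^ Suc k - 1 = y * (y ^ k - 1) + (y - 1)" by (simp add: algebra_simps)
    also have "\<dots> = ([:int k:] + 1) * (y - 1) + ([:int k:] + y * z) * ((y - 1) * (y - 1))"
    proof -
      have "y * (c * (y - 1) + z * ((y - 1) * (y - 1))) + (y - 1) =
          (c + 1) * (y - 1) + (c + y * z) * ((y - 1) * (y - 1))" for c
        by (simp add: algebra_simps)
      then show ?thesis unfolding z .
    qed
    also have "[:int k:] + 1 = [:int (Suc k):]" by (simp add: one_pCons)
    finally show ?case by blast
  qed (auto intro: exI[of _ 0])
  then obtain z where z: "y ^ m - 1 = [:int m:] * (y - 1) + z * ((y - 1) * (y - 1))" by blast
  have "(\<tau> ^ (s * L * m) - 1) *s v \<in> R" for v
  proof -
    have "(\<tau> ^ (s * L * m) - 1) *s v = [:int m:] *s (y - 1) *s v + z *s (y - 1) *s (y - 1) *s v"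
      using z unfolding y_def power_mult by (simp only: scale_left_distrib scale_scale)
    also have "\<dots> \<in> R"
      by (rule subspace_add[OF subspace_R 2 subspace_scale[OF subspace_R 1]])
    finally show ?thesis .
  qed
  then show ?thesis
    using s L(1) m by (intro exI[of _ "s * L * m"]) simp
qed

text \<open>A nonzero annihilator of least degree has a nonzero constant coefficient, since
  \<open>R_cancel\<close> would remove a factor \<open>\<tau>\<close>. Hence only finitely many
  primes divide its extreme coefficients.\<close>

lemma annihilator_coeff_0:
  "\<exists>D. (\<forall>v. D *s v \<in> R) \<and> Polynomial.lead_coeff D * poly.coeff D 0 \<noteq> 0"
proof -
  obtain D0 where "poly D0 1 = 1" "\<forall>v. D0 *s v \<in> R" using annihilator_at_one by blast
  then have "\<exists>D. D \<noteq> 0 \<and> (\<forall>v. D *s v \<in> R)" by (intro exI[of _ D0]) auto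
  then obtain D where D: "D \<noteq> 0" "\<And>v. D *s v \<in> R"
    "\<And>E. E \<noteq> 0 \<Longrightarrow> (\<forall>v. E *s v \<in> R) \<Longrightarrow> Polynomial.degree D \<le> Polynomial.degree E"
    by (metis (no_types, lifting) ex_has_least_nat[of "\<lambda>D. D \<noteq> 0 \<and> (\<forall>v. D *s v \<in> R)" _ Polynomial.degree])
  have "poly.coeff D 0 \<noteq> 0"
  proof
    assume 0: "poly.coeff D 0 = 0"
    obtain a E where "D = pCons a E" by (cases D)
    with 0 have E: "D = pCons 0 E" by simp
    have "E *s v \<in> R" for v
      using D(2)[of v] R_cancel unfolding E scale_pCons[of 0 E] by simp
    then have "Polynomial.degree D \<le> Polynomial.degree E" using D(1,3) E by auto
    then show False using D(1) E by auto
  qed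
  then show ?thesis using D by auto
qed

theorem finite_order_or_torsion:
  "(\<exists>L\<ge>1. \<forall>v. (\<tau> ^ L - 1) *s v \<in> R) \<or>
   (\<forall>N::nat. \<exists>r\<ge>1. \<exists>P. finite P \<and> card P = N \<and> (\<forall>p\<in>P. Factorial_Ring.prime (p::nat) \<and>
      (\<exists>v. \<not> (\<exists>w. v - (\<tau> ^ r - 1) *s w \<in> R) \<and> (\<exists>w. [:int p:] *s v - (\<tau> ^ r - 1) *s w \<in> R))))"
\<comment> \<open>If the image of some \<open>t^s - 1\<close> has bounded exponent, then
  \<open>t\<close> has finite order. Otherwise, a prime of \<open>P\<close> missing from the torsion
  would produce such an exponent for \<open>r\<close>.\<close>
proof (cases "\<exists>s\<ge>1. \<exists>n. n \<noteq> 0 \<and> (\<forall>v. [:n:] *s (\<tau> ^ s - 1) *s v \<in> R)")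
  case True
  then show ?thesis using finite_order_of_torsion by blast
next
  case no_tor: False
  obtain D where D: "\<And>v. D *s v \<in> R" "Polynomial.lead_coeff D * poly.coeff D 0 \<noteq> 0"
    using annihilator_coeff_0 by blast
  define e where "e = Polynomial.lead_coeff D * poly.coeff D 0"
  have "{p::nat. Factorial_Ring.prime p} - {p. Factorial_Ring.prime p \<and> \<not> int p dvd e} \<subseteq> {p. p dvd nat \<bar>e\<bar>}"
    by auto
  moreover have "finite {p. p dvd nat \<bar>e\<bar>}"
    by (rule finite_divisors_nat) (use D(2) in \<open>unfold e_def, linarith\<close>)
  ultimately have "infinite {p. Factorial_Ring.prime p \<and> \<not> int p dvd e}"
    using primes_infinite by (meson finite_subset Diff_infinite_finite)
  then have P: "\<exists>P. finite P \<and> card P = N \<and> P \<subseteq> {p. Factorial_Ring.prime p \<and> \<not> int p dvd e}" for N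
    by (rule infinite_arbitrarily_large)
  have "\<exists>r\<ge>1. \<exists>P. finite P \<and> card P = N \<and> (\<forall>p\<in>P. Factorial_Ring.prime (p::nat) \<and>
      (\<exists>v. \<not> (\<exists>w. v - (\<tau> ^ r - 1) *s w \<in> R) \<and> (\<exists>w. [:int p:] *s v - (\<tau> ^ r - 1) *s w \<in> R)))" for N :: nat
  proof -
    obtain P where P: "finite P" "card P = N"
      "\<And>p. p \<in> P \<Longrightarrow> Factorial_Ring.prime p" "\<And>p. p \<in> P \<Longrightarrow> \<not> int p dvd e"
      using P[of N] by blast
    have "\<exists>L\<ge>1. \<forall>v. \<exists>w. (\<tau> ^ L - 1) *s v - [:int p:] *s w \<in> R" if p: "p \<in> P" for p
    proof -
      have "p > 0" using P(3)[OF p] by (rule prime_gt_0_nat)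
      then obtain Y where Y: "finite Y" "\<And>v. \<exists>y\<in>Y. \<exists>w. v - y - [:int p:] *s w \<in> R"
        using finite_mod[OF laurent_sub_R] by blast
      then show ?thesis
        using finite_order[OF laurent_sub_add_multiples[OF laurent_sub_R] Y(1), of "[:int p:]"] by blast
    qed
    then obtain L where L: "\<And>p. p \<in> P \<Longrightarrow> L p \<ge> 1"
      "\<And>p v. p \<in> P \<Longrightarrow> \<exists>w. (\<tau> ^ L p - 1) *s v - [:int p:] *s w \<in> R"
      by metis
    \<comment> \<open>A common multiple of the orders \<open>L p\<close>, so that
      \<open>t^r - 1\<close> maps everything into the multiples of \<open>p\<close>, for all
      \<open>p\<close> in \<open>P\<close> at once.\<close>
    define r where "r = prod L P"
    have r: "r \<ge> 1" unfolding r_def using L(1) by (rule prod_ge_1)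
    have "\<exists>v. \<not> (\<exists>w. v - (\<tau> ^ r - 1) *s w \<in> R) \<and> (\<exists>w. [:int p:] *s v - (\<tau> ^ r - 1) *s w \<in> R)"
      if p: "p \<in> P" for p
    proof (rule ccontr)
      assume contr: "\<not> ?thesis"
      have "L p dvd r" unfolding r_def by (rule dvd_prodI[OF P(1) p])
      then obtain k where k: "r = L p * k" by auto
      have "\<tau> ^ L p - 1 dvd (\<tau> ^ L p) ^ k - 1"
        by (simp add: power_diff_1_eq)
      then obtain a where a: "\<tau> ^ r - 1 = (\<tau> ^ L p - 1) * a"
        by (auto simp: k power_mult dvd_def)
      define U where "U = {v. (\<tau> ^ r - 1) *s v \<in> R}"
      have U: "laurent_sub U"
        unfolding U_def by (rule laurent_sub_vimage[OF laurent_sub_R])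
      \<comment> \<open>Modulo \<open>R\<close>, \<open>(t^r - 1) v = p w\<close>. Since the
        cokernel of \<open>t^r - 1\<close> has no \<open>p\<close>-torsion,
        \<open>w = (t^r - 1) w'\<close>, so \<open>v - p w'\<close> lies in the kernel
        \<open>U\<close>.\<close>
      have "\<exists>w. v - [:int p:] *s w \<in> U" for v
      proof -
        obtain w where w: "(\<tau> ^ r - 1) *s v - [:int p:] *s w \<in> R"
          using L(2)[OF p, of "a *s v"] by (auto simp only: a scale_scale)
        have "[:int p:] *s w - (\<tau> ^ r - 1) *s v \<in> R"
          using subspace_neg[OF subspace_R w] by simp
        then obtain w' where w': "w - (\<tau> ^ r - 1) *s w' \<in> R"
          using contr by blast
        have "(\<tau> ^ r - 1) *s (v - [:int p:] *s w') =
            ((\<tau> ^ r - 1) *s v - [:int p:] *s w) + [:int p:] *s (w - (\<tau> ^ r - 1) *s w')"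
          by (simp only: scale_right_diff_distrib scale_left_commute[of "[:int p:]"]) simp
        also have "\<dots> \<in> R"
          by (rule subspace_add[OF subspace_R w subspace_scale[OF subspace_R w']])
        finally show ?thesis unfolding U_def by blast
      qed
      then obtain n where "n \<noteq> 0" "\<And>v. [:n:] *s v \<in> U"
        using torsion_of_divisible[OF U, of "int p" D] D(1) P(3,4)[OF p] by (auto simp: e_def)
      then have "\<forall>v. [:n:] *s (\<tau> ^ r - 1) *s v \<in> R"
        unfolding U_def by (simp only: mem_Collect_eq scale_left_commute[of "[:n:]"]) simp
      then show False using no_tor r \<open>n \<noteq> 0\<close> by blast
    qed
    then show ?thesis using r P by (intro exI[of _ r] conjI exI[of _ P]) auto
  qed
  then show ?thesis by blast
qed

text \<open>\<open>t^r - 1\<close> annihilates its own cokernel and has extreme coefficients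
  \<open>1\<close> and \<open>-1\<close>, so \<open>integral_span\<close> leaves no denominators:
  the cokernel is finitely generated over the integers.\<close>

theorem finite_torsion_quotient:
  assumes r: "r \<ge> 1"
  shows "\<exists>Y. finite Y \<and> (\<forall>v n. n \<noteq> 0 \<longrightarrow> (\<exists>w. [:n:] *s v - (\<tau> ^ r - 1) *s w \<in> R) \<longrightarrow>
    (\<exists>y\<in>Y. \<exists>w. v - y - (\<tau> ^ r - 1) *s w \<in> R))"
proof -
  define q where "q = \<tau> ^ r - 1"
  define U where "U = {v. \<exists>w. v - q *s w \<in> R}"
  have U: "laurent_sub U"
    unfolding U_def by (rule laurent_sub_add_multiples[OF laurent_sub_R])
  then have sU: "subspace U" by (simp add: laurent_sub_def)
  have qU: "q *s v \<in> U" for v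
    unfolding U_def using subspace_0[OF subspace_R] by (auto intro!: exI[of _ v])
  have "Polynomial.lead_coeff q = 1"
  proof -
    have "Polynomial.degree (- 1 :: int poly) < Polynomial.degree (\<tau> ^ r)" using r by (simp add: degree_power_eq)
    then have "Polynomial.lead_coeff (- 1 + \<tau> ^ r) = Polynomial.lead_coeff (\<tau> ^ r)" by (rule lead_coeff_add_le)
    then show ?thesis by (simp add: q_def lead_coeff_power)
  qed
  moreover have "poly.coeff q 0 = -1"
    using r by (simp add: q_def poly_0_coeff_0[symmetric])
  ultimately have e: "Polynomial.lead_coeff q * poly.coeff q 0 = -1" by simp
  define T where "T = (\<lambda>(i, g). \<tau> ^ i *s g) ` ({..Polynomial.degree q} \<times> S)"
  have T: "finite T" unfolding T_def using finite_S by simp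
  have all: "v \<in> Z.span (T \<union> U)" for v
  proof -
    obtain k where k: "[:(-1) ^ k:] *s v \<in> Z.span (T \<union> U)"
      using integral_span[OF U qU, of v] unfolding e T_def by blast
    have "[:(-1) ^ k:] * [:(-1) ^ k:] = (1 :: int poly)"
      by (cases "even k") (simp_all add: one_pCons)
    with Z.span_scale[OF k, of "(-1) ^ k"] show ?thesis
      by (simp only: scale_scale scale_one)
  qed
  obtain Y where Y: "finite Y"
      "\<forall>v\<in>Z.span (T \<union> U). \<forall>n. n \<noteq> 0 \<and> [:n:] *s v \<in> U \<longrightarrow> (\<exists>y\<in>Y. v - y \<in> U)"
    using Z.finite_torsion[OF T subspace_Z[OF sU]] by (elim exE conjE)
  have "n \<noteq> 0 \<longrightarrow> [:n:] *s v \<in> U \<longrightarrow> (\<exists>y\<in>Y. v - y \<in> U)" for v n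
    using bspec[OF Y(2) all[of v]] by blast
  then show ?thesis
    unfolding U_def q_def mem_Collect_eq using Y(1) by (intro exI[of _ Y]) simp
qed

end

section \<open>Abelian groups with an automorphism\<close>

context int_module begin

text \<open>Horner evaluation of \<open>p\<close> at the map \<open>f\<close>, so that the variable
  acts as \<open>f\<close>.\<close>

definition poly_scale :: "('m \<Rightarrow> 'm) \<Rightarrow> int poly \<Rightarrow> 'm \<Rightarrow> 'm" where
  "poly_scale f p v = fold_coeffs (\<lambda>a w. a *z v + f w) p 0"

context
  fixes f :: "'m \<Rightarrow> 'm"
  assumes f_add: "\<And>x y. f (x + y) = f x + f y"
begin

lemma f_zero: "f 0 = 0"
  using f_add[of 0 0] by simp

lemma f_scale: "f (n *z v) = n *z f v"
proof (induction n rule: int_induct[where k = 0])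
  case (step1 i)
  then show ?case by (simp add: scale_left_distrib f_add)
next
  case (step2 i)
  have "f ((i - 1) *z v) + f v = f (i *z v)"
    by (simp add: scale_left_diff_distrib flip: f_add)
  with step2 show ?case
    by (simp add: scale_left_diff_distrib eq_diff_eq)
qed (simp add: f_zero)

lemma poly_scale_0: "poly_scale f 0 v = 0"
  by (simp add: poly_scale_def)

lemma poly_scale_pCons: "poly_scale f (pCons a p) v = a *z v + f (poly_scale f p v)"
  by (cases "p = 0"; cases "a = 0") (simp_all add: poly_scale_def f_zero)

lemma poly_scale_smult: "poly_scale f (Polynomial.smult a p) v = a *z poly_scale f p v"
  by (induction p) (simp_all add: poly_scale_0 poly_scale_pCons f_scale scale_right_distrib)

lemma poly_scale_add: "poly_scale f (p + q) v = poly_scale f p v + poly_scale f q v"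
  by (induction p q rule: poly_induct2)
    (simp_all add: poly_scale_0 poly_scale_pCons f_add scale_left_distrib algebra_simps)

lemma module_poly_scale: "Modules.module (poly_scale f)"
proof
  show "poly_scale f p (x + y) = poly_scale f p x + poly_scale f p y" for p x y
    by (induction p) (simp_all add: poly_scale_0 poly_scale_pCons f_add scale_right_distrib algebra_simps)
  show "poly_scale f (p + q) x = poly_scale f p x + poly_scale f q x" for p q x
    by (rule poly_scale_add)
  show "poly_scale f p (poly_scale f q x) = poly_scale f (p * q) x" for p q x
    by (induction p) (simp_all add: poly_scale_0 poly_scale_pCons poly_scale_add poly_scale_smult)
  show "poly_scale f 1 x = x" for x
    by (simp add: one_pCons poly_scale_0 poly_scale_pCons f_zero)
qed

end

end

interpretation frag: int_module frag_cmul
  by unfold_locales (simp_all add: frag_cmul_distrib frag_cmul_distrib2)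

text \<open>Lagrange in the torsion subgroup, where \<open>x\<close> has order exactly
  \<open>p\<close>.\<close>

lemma prime_dvd_card_torsion_part:
  assumes "comm_group H" and fin: "finite (torsion_part H)" and p: "Factorial_Ring.prime p"
    and x: "x \<in> carrier H" "x \<noteq> \<one>\<^bsub>H\<^esub>" "x [^]\<^bsub>H\<^esub> p = \<one>\<^bsub>H\<^esub>"
  shows "p dvd card (torsion_part H)"
proof -
  interpret comm_group H by fact
  have sub: "subgroup (torsion_part H) H"
  proof (rule subgroupI)
    show "torsion_part H \<noteq> {}" by (auto simp: torsion_part_def intro!: exI[of _ "\<one>\<^bsub>H\<^esub>"] exI[of _ 1])
    show "inv\<^bsub>H\<^esub> a \<in> torsion_part H" if "a \<in> torsion_part H" for a
      using that by (auto simp: torsion_part_def nat_pow_inv)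
    show "a \<otimes>\<^bsub>H\<^esub> b \<in> torsion_part H" if ab: "a \<in> torsion_part H" "b \<in> torsion_part H" for a b
    proof -
      obtain m n :: nat where mn: "m > 0" "n > 0" "a [^]\<^bsub>H\<^esub> m = \<one>\<^bsub>H\<^esub>" "b [^]\<^bsub>H\<^esub> n = \<one>\<^bsub>H\<^esub>"
          "a \<in> carrier H" "b \<in> carrier H"
        using ab by (auto simp: torsion_part_def)
      have "a [^]\<^bsub>H\<^esub> (m * n) = \<one>\<^bsub>H\<^esub>" "b [^]\<^bsub>H\<^esub> (n * m) = \<one>\<^bsub>H\<^esub>"
        using mn by (simp_all flip: nat_pow_pow)
      then have "(a \<otimes>\<^bsub>H\<^esub> b) [^]\<^bsub>H\<^esub> (m * n) = \<one>\<^bsub>H\<^esub>"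
        using mn by (simp add: nat_pow_distrib mult.commute)
      then show ?thesis
        using mn by (auto simp: torsion_part_def intro!: exI[of _ "m * n"])
    qed
  qed (auto simp: torsion_part_def)
  interpret T: group "H\<lparr>carrier := torsion_part H\<rparr>"
    using sub by (rule subgroup_imp_group)
  have "ord x dvd p" using x by (simp add: pow_eq_id)
  moreover have "ord x \<noteq> 1" using x(1,2) pow_ord_eq_1[OF x(1)] by (metis nat_pow_one nat_pow_0 One_nat_def nat_pow_eone)
  ultimately have "ord x = p" using p by (metis prime_nat_iff)
  have xT: "x \<in> torsion_part H" using x prime_gt_0_nat[OF p] by (auto simp: torsion_part_def)
  have "x [^]\<^bsub>H\<lparr>carrier := torsion_part H\<rparr>\<^esub> card (torsion_part H) = \<one>\<^bsub>H\<lparr>carrier := torsion_part H\<rparr>\<^esub>"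
    using T.pow_order_eq_1[of x] xT by (simp add: Coset.order_def)
  then have "x [^]\<^bsub>H\<^esub> card (torsion_part H) = \<one>\<^bsub>H\<^esub>"
    by (simp flip: nat_pow_consistent)
  then show ?thesis using x \<open>ord x = p\<close> by (simp add: pow_eq_id)
qed

lemma (in comm_group) subgroup_endo_diff:
  assumes t: "t \<in> hom G G"
  shows "subgroup ((\<lambda>m. t m \<otimes> inv m) ` carrier G) G"
proof (rule subgroupI)
  interpret t: group_hom G G t by unfold_locales (rule t)
  show "inv x \<in> (\<lambda>m. t m \<otimes> inv m) ` carrier G" if x: "x \<in> (\<lambda>m. t m \<otimes> inv m) ` carrier G" for x
  proof -
    obtain m where "m \<in> carrier G" "x = t m \<otimes> inv m" using x by auto
    then show ?thesis
      by (intro image_eqI[of _ _ "inv m"]) (simp_all add: inv_mult)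
  qed
  show "x \<otimes> y \<in> (\<lambda>m. t m \<otimes> inv m) ` carrier G"
    if xy: "x \<in> (\<lambda>m. t m \<otimes> inv m) ` carrier G" "y \<in> (\<lambda>m. t m \<otimes> inv m) ` carrier G" for x y
  proof -
    obtain m n where "m \<in> carrier G" "x = t m \<otimes> inv m" "n \<in> carrier G" "y = t n \<otimes> inv n"
      using xy by auto
    then show ?thesis
      by (intro image_eqI[of _ _ "m \<otimes> n"]) (simp_all add: inv_mult m_ac)
  qed
qed (use t in \<open>auto simp: hom_def\<close>)

text \<open>Passage from a group with a carrier to a module on a whole type, by presenting
  \<open>M\<close> as a quotient of a free abelian group. The hypothesis \<open>gen\<close> says
  that \<open>F\<close> generates \<open>M\<close> over Laurent polynomials, \<open>surj\<close>
  that \<open>t - 1\<close> is onto.\<close>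

theorem comm_group_torsion_dichotomy:
  fixes M :: "('a, 'b) monoid_scheme" and t :: "'a \<Rightarrow> 'a" and b :: "nat \<Rightarrow> nat"
  assumes M: "comm_group M" and t: "t \<in> hom M M" and bij: "bij_betw t (carrier M) (carrier M)"
    and F: "finite F" "F \<subseteq> carrier M"
    and gen: "\<And>U. subgroup U M \<Longrightarrow> F \<subseteq> U \<Longrightarrow> (\<And>m. m \<in> carrier M \<Longrightarrow> t m \<in> U \<longleftrightarrow> m \<in> U) \<Longrightarrow>
      U = carrier M"
    and surj: "\<And>m. m \<in> carrier M \<Longrightarrow> \<exists>m'\<in>carrier M. m = t m' \<otimes>\<^bsub>M\<^esub> inv\<^bsub>M\<^esub> m'"
    and b: "\<And>r. r \<ge> 1 \<Longrightarrow>
      b r = card (torsion_part (M Mod (\<lambda>m. (t ^^ r) m \<otimes>\<^bsub>M\<^esub> inv\<^bsub>M\<^esub> m) ` carrier M))"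
  shows "(\<exists>p\<ge>1. \<forall>r\<ge>1. b (r + p) = b r) \<or>
         (\<forall>N::nat. \<exists>r\<ge>1. card (prime_factors (b r)) \<ge> N)"
proof -
  interpret M: comm_group M by fact
  define J where "J r = (\<lambda>m. (t ^^ r) m \<otimes>\<^bsub>M\<^esub> inv\<^bsub>M\<^esub> m) ` carrier M" for r
  interpret t: group_hom M M t by unfold_locales (rule t)
  have tr: "(t ^^ r) \<in> hom M M" for r
    by (induction r) (use t in \<open>auto simp: hom_def Pi_def\<close>)
  \<comment> \<open>Symbols outside the carrier evaluate to the unit. The map \<open>t'\<close>
    below follows the same convention, so that \<open>\<pi>\<close> intertwines \<open>shift\<close>
    and \<open>t\<close> on the whole type.\<close>
  obtain \<pi> where \<pi>: "\<pi> \<in> hom (free_Abelian_group UNIV) M"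
    "\<And>x. \<pi> (frag_of x) = (if x \<in> carrier M then x else \<one>\<^bsub>M\<^esub>)"
    using M.free_Abelian_group_universal[of "\<lambda>x. if x \<in> carrier M then x else \<one>\<^bsub>M\<^esub>" UNIV] by auto
  interpret \<pi>: group_hom "free_Abelian_group UNIV" M \<pi>
    by (intro group_hom.intro group_hom_axioms.intro group_free_Abelian_group M.group_axioms \<pi>)
  have \<pi>c [simp]: "\<pi> v \<in> carrier M" for v
    using \<pi>.hom_closed[of v] by simp
  have \<pi>0 [simp]: "\<pi> 0 = \<one>\<^bsub>M\<^esub>"
    using \<pi>.hom_one by simp
  have \<pi>add: "\<pi> (v + w) = \<pi> v \<otimes>\<^bsub>M\<^esub> \<pi> w" for v w
    using \<pi>.hom_mult[of v w] by simp
  have \<pi>minus: "\<pi> (- v) = inv\<^bsub>M\<^esub> \<pi> v" for v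
    using \<pi>.hom_inv[of v] by simp
  have \<pi>diff: "\<pi> (v - w) = \<pi> v \<otimes>\<^bsub>M\<^esub> inv\<^bsub>M\<^esub> \<pi> w" for v w
    using \<pi>add[of v "- w"] \<pi>minus by simp
  have \<pi>cmul: "\<pi> (frag_cmul n v) = \<pi> v [^]\<^bsub>M\<^esub> n" for n v
    using \<pi>.hom_int_pow[of v n] by (simp add: int_pow_free_Abelian_group)
  have \<pi>surj: "\<exists>v. m = \<pi> v" if "m \<in> carrier M" for m
    using \<pi>(2)[of m] that by metis
  define t' where "t' x = (if x \<in> carrier M then t x else \<one>\<^bsub>M\<^esub>)" for x
  define shift where "shift = frag_extend (frag_of \<circ> t')"
  have shift_add: "shift (v + w) = shift v + shift w" for v w
    by (simp add: shift_def frag_extend_add)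
  have \<pi>shift: "\<pi> (shift v) = t (\<pi> v)" for v
    using subset_UNIV[of "Poly_Mapping.keys v"]
  proof (induction v rule: frag_induction)
    case (diff v w)
    then show ?case
      by (simp add: shift_def frag_extend_diff \<pi>diff)
  qed (auto simp: shift_def \<pi>(2) t'_def)
  define sc where "sc = frag.poly_scale shift"
  interpret sc: Modules.module sc
    unfolding sc_def by (rule frag.module_poly_scale) (rule shift_add)
  note sc_pCons = frag.poly_scale_pCons[of shift, OF shift_add, folded sc_def]
  have shift0: "shift 0 = 0" by (simp add: shift_def)
  have sc_tau: "sc \<tau> v = shift v" for v
    by (simp add: sc_pCons shift0)
  have sc_const: "sc [:n:] v = frag_cmul n v" for n v
    by (simp add: sc_pCons shift0)
  have sc_power: "\<pi> (sc (\<tau> ^ r) v) = (t ^^ r) (\<pi> v)" for r v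
  proof (induction r)
    case (Suc r)
    have "sc (\<tau> ^ Suc r) v = shift (sc (\<tau> ^ r) v)"
      unfolding power_Suc sc.scale_scale[symmetric] sc_tau ..
    then show ?case using Suc by (simp add: \<pi>shift)
  qed simp
  define R where "R = {v. \<pi> v = \<one>\<^bsub>M\<^esub>}"
  define S where "S = frag_of ` F"
  have R_diff: "v - w \<in> R \<longleftrightarrow> \<pi> v = \<pi> w" for v w
    unfolding R_def mem_Collect_eq \<pi>diff by (metis M.inv_closed M.r_inv M.right_cancel \<pi>c)
  have R_sub: "sc.subspace R"
  proof (rule sc.subspaceI)
    show "sc p v \<in> R" if v: "v \<in> R" for p v
    proof (induction p)
      case (pCons a p)
      then show ?case using v
        by (simp add: R_def sc_pCons \<pi>add \<pi>cmul \<pi>shift M.int_pow_one)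
    qed (simp add: R_def)
  qed (auto simp: R_def \<pi>add)
  interpret laurent_module sc S R
  proof
    show "finite S" using F by (simp add: S_def)
    show "sc.subspace R" by fact
    show "v \<in> R" if "sc \<tau> v \<in> R" for v
    proof -
      have "t (\<pi> v) = t \<one>\<^bsub>M\<^esub>" using that by (simp add: R_def sc_tau \<pi>shift)
      then show ?thesis using bij by (auto simp: R_def bij_betw_def inj_on_def)
    qed
    show "\<exists>w. v - sc \<tau> w \<in> R" for v
    proof -
      obtain m where "m \<in> carrier M" "t m = \<pi> v" using bij \<pi>c[of v] unfolding bij_betw_def by (metis imageE)
      then show ?thesis using \<pi>surj[of m] unfolding R_diff sc_tau \<pi>shift by metis
    qed
    show "\<exists>w. v - sc [:-1, 1:] w \<in> R" for v
    proof -
      obtain m where "m \<in> carrier M" "\<pi> v = t m \<otimes>\<^bsub>M\<^esub> inv\<^bsub>M\<^esub> m" using surj[OF \<pi>c[of v]] by auto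
      moreover have "\<pi> (sc [:-1, 1:] w) = t (\<pi> w) \<otimes>\<^bsub>M\<^esub> inv\<^bsub>M\<^esub> \<pi> w" for w
        by (simp add: sc_pCons shift0 \<pi>diff \<pi>shift)
      ultimately show ?thesis using \<pi>surj[of m] unfolding R_diff by metis
    qed
    show "\<exists>N. sc (\<tau> ^ N) v \<in> sc.span (S \<union> R)" for v
    proof -
      \<comment> \<open>The image of \<open>V\<close> under \<open>\<pi>\<close> satisfies the
        hypotheses of \<open>gen\<close>. As \<open>V\<close> contains \<open>R\<close>, it can be
        recovered from this image (\<open>V_iff\<close>).\<close>
      define V where "V = {v. \<exists>N. sc (\<tau> ^ N) v \<in> sc.span (S \<union> R)}"
      have V_sub: "sc.subspace V"
      proof (rule sc.subspaceI)
        show "0 \<in> V" by (auto simp: V_def sc.span_zero)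
        show "sc p x \<in> V" if "x \<in> V" for p x
          using that unfolding V_def by (auto simp: sc.scale_left_commute[of _ p] simp del: sc.scale_scale intro: sc.span_scale)
        show "x + y \<in> V" if xy: "x \<in> V" "y \<in> V" for x y
        proof -
          obtain k l where kl: "sc (\<tau> ^ k) x \<in> sc.span (S \<union> R)" "sc (\<tau> ^ l) y \<in> sc.span (S \<union> R)"
            using xy by (auto simp: V_def)
          have "sc (\<tau> ^ (k + l)) (x + y) = sc (\<tau> ^ l) (sc (\<tau> ^ k) x) + sc (\<tau> ^ k) (sc (\<tau> ^ l) y)"
            by (simp add: sc.scale_right_distrib power_add mult.commute)
          also have "\<dots> \<in> sc.span (S \<union> R)"
            by (rule sc.span_add[OF sc.span_scale[OF kl(1)] sc.span_scale[OF kl(2)]])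
          finally show ?thesis unfolding V_def by blast
        qed
      qed
      have V_can: "x \<in> V" if x: "sc \<tau> x \<in> V" for x
      proof -
        obtain N where "sc (\<tau> ^ N) (sc \<tau> x) \<in> sc.span (S \<union> R)" using x by (auto simp: V_def)
        then have "sc (\<tau> ^ Suc N) x \<in> sc.span (S \<union> R)"
          unfolding power_Suc2 sc.scale_scale[symmetric] .
        then show ?thesis unfolding V_def by blast
      qed
      have SR: "S \<union> R \<subseteq> V" by (auto simp: V_def intro!: exI[of _ 0] sc.span_base)
      have V_iff: "\<pi> x \<in> \<pi> ` V \<longleftrightarrow> x \<in> V" for x
      proof
        assume "\<pi> x \<in> \<pi> ` V"
        then obtain y where y: "y \<in> V" "\<pi> x = \<pi> y" by auto
        then have "x - y \<in> V" using SR R_diff by auto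
        then show "x \<in> V" using sc.subspace_add[OF V_sub] y(1) by fastforce
      qed auto
      have "\<pi> ` V = carrier M"
      proof (rule gen)
        show "subgroup (\<pi> ` V) M"
        proof (rule M.subgroupI)
          show "inv\<^bsub>M\<^esub> a \<in> \<pi> ` V" if a: "a \<in> \<pi> ` V" for a
          proof -
            obtain v where "v \<in> V" "a = \<pi> v" using a by auto
            then show ?thesis using sc.subspace_neg[OF V_sub, of v] \<pi>minus[of v] by force
          qed
          show "a \<otimes>\<^bsub>M\<^esub> c \<in> \<pi> ` V" if ac: "a \<in> \<pi> ` V" "c \<in> \<pi> ` V" for a c
          proof -
            obtain v w where "v \<in> V" "a = \<pi> v" "w \<in> V" "c = \<pi> w" using ac by auto
            then show ?thesis using sc.subspace_add[OF V_sub, of v w] \<pi>add[of v w] by force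
          qed
        qed (use sc.subspace_0[OF V_sub] in auto)
        show "F \<subseteq> \<pi> ` V"
        proof
          fix g assume g: "g \<in> F"
          then have "frag_of g \<in> V" using SR by (auto simp: S_def)
          moreover have "\<pi> (frag_of g) = g" using g F \<pi>(2) by auto
          ultimately show "g \<in> \<pi> ` V" by force
        qed
        show "t m \<in> \<pi> ` V \<longleftrightarrow> m \<in> \<pi> ` V" if m: "m \<in> carrier M" for m
        proof -
          obtain w where w: "m = \<pi> w" using \<pi>surj[OF m] by blast
          have "t m = \<pi> (sc \<tau> w)" by (simp add: w sc_tau \<pi>shift)
          then show ?thesis
            using V_iff V_can sc.subspace_scale[OF V_sub, of w \<tau>] w by auto
        qed
      qed
      then have "v \<in> V" using V_iff \<pi>c by blast
      then show ?thesis by (simp add: V_def)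
    qed
  qed
  have in_J: "(\<exists>w. v - sc (\<tau> ^ r - 1) w \<in> R) \<longleftrightarrow> \<pi> v \<in> J r" for v r
  proof -
    have "\<pi> (sc (\<tau> ^ r - 1) w) = (t ^^ r) (\<pi> w) \<otimes>\<^bsub>M\<^esub> inv\<^bsub>M\<^esub> \<pi> w" for w
      by (simp only: sc.scale_left_diff_distrib \<pi>diff sc_power sc.scale_one)
    then have "(\<exists>w. v - sc (\<tau> ^ r - 1) w \<in> R) \<longleftrightarrow> (\<exists>w. \<pi> v = (t ^^ r) (\<pi> w) \<otimes>\<^bsub>M\<^esub> inv\<^bsub>M\<^esub> \<pi> w)"
      by (simp only: R_diff)
    also have "\<dots> \<longleftrightarrow> \<pi> v \<in> J r"
      unfolding J_def using \<pi>surj by (metis (no_types, lifting) imageE imageI \<pi>c)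
    finally show ?thesis .
  qed
  have J_sub: "subgroup (J r) M" for r
    unfolding J_def by (rule M.subgroup_endo_diff[OF tr])
  have J_normal: "J r \<lhd> M" for r
    using J_sub by (rule M.normal_iff_subgroup[THEN iffD2])
  define \<kappa> where "\<kappa> r v = J r #>\<^bsub>M\<^esub> \<pi> v" for r v
  have H: "comm_group (M Mod J r)" for r
    using J_sub by (rule M.abelian_FactGroup)
  have \<kappa>_carrier: "\<kappa> r v \<in> carrier (M Mod J r)" for r v
    by (auto simp: \<kappa>_def FactGroup_def RCOSETS_def)
  have \<kappa>_surj: "\<exists>v. h = \<kappa> r v" if "h \<in> carrier (M Mod J r)" for r h
    using that \<pi>surj by (auto simp: \<kappa>_def FactGroup_def RCOSETS_def)
  have \<kappa>_add: "\<kappa> r (v + w) = \<kappa> r v \<otimes>\<^bsub>M Mod J r\<^esub> \<kappa> r w" for r v w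
    using normal.rcos_sum[OF J_normal] by (simp add: \<kappa>_def \<pi>add)
  have \<kappa>_one: "\<kappa> r v = \<one>\<^bsub>M Mod J r\<^esub> \<longleftrightarrow> \<pi> v \<in> J r" for r v
    using M.coset_join1[of "J r" "\<pi> v"] M.coset_join2[of "\<pi> v" "J r"] J_sub by (auto simp: \<kappa>_def)
  have \<kappa>_eq: "\<kappa> r v = \<kappa> r w \<longleftrightarrow> \<pi> (v - w) \<in> J r" for r v w
  proof -
    interpret H: comm_group "M Mod J r" by (rule H)
    have "\<kappa> r v = \<kappa> r (v - w) \<otimes>\<^bsub>M Mod J r\<^esub> \<kappa> r w"
      unfolding \<kappa>_add[symmetric] by simp
    then have "\<kappa> r v = \<kappa> r w \<longleftrightarrow> \<kappa> r (v - w) = \<one>\<^bsub>M Mod J r\<^esub>"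
      by (metis H.l_one H.one_closed H.right_cancel \<kappa>_carrier)
    then show ?thesis by (simp only: \<kappa>_one)
  qed
  have \<kappa>_pow: "\<kappa> r v [^]\<^bsub>M Mod J r\<^esub> n = \<kappa> r (sc [:int n:] v)" for r v and n :: nat
    using normal.FactGroup_pow[OF J_normal \<pi>c] by (simp add: \<kappa>_def sc_const \<pi>cmul int_pow_int)
  have fin: "finite (torsion_part (M Mod J r))" if r: "r \<ge> 1" for r
  proof -
    obtain Y where Y: "finite Y" "\<And>v n. n \<noteq> 0 \<Longrightarrow> \<pi> (sc [:n:] v) \<in> J r \<Longrightarrow> \<exists>y\<in>Y. \<pi> (v - y) \<in> J r"
      using finite_torsion_quotient[OF r] unfolding in_J by blast
    have "torsion_part (M Mod J r) \<subseteq> \<kappa> r ` Y"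
    proof
      fix h assume h: "h \<in> torsion_part (M Mod J r)"
      then obtain v where v: "h = \<kappa> r v" using \<kappa>_surj unfolding torsion_part_def by blast
      from h obtain n :: nat where n: "n > 0" "h [^]\<^bsub>M Mod J r\<^esub> n = \<one>\<^bsub>M Mod J r\<^esub>"
        by (auto simp: torsion_part_def)
      then have "\<pi> (sc [:int n:] v) \<in> J r" by (simp only: v \<kappa>_pow \<kappa>_one)
      then obtain y where "y \<in> Y" "\<pi> (v - y) \<in> J r" using Y(2)[of "int n" v] n by auto
      then show "h \<in> \<kappa> r ` Y" using v \<kappa>_eq by blast
    qed
    then show ?thesis using Y(1) finite_surj by blast
  qed
  consider (period) L where "L \<ge> 1" "\<And>v. sc (\<tau> ^ L - 1) v \<in> R"
    | (primes) "\<forall>N::nat. \<exists>r\<ge>1. \<exists>P. finite P \<and> card P = N \<and> (\<forall>p\<in>P. Factorial_Ring.prime (p::nat) \<and>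
      (\<exists>v. \<pi> v \<notin> J r \<and> \<pi> (sc [:int p:] v) \<in> J r))"
    using finite_order_or_torsion unfolding in_J by blast
  then show ?thesis
  proof cases
    case period
    have tL: "(t ^^ L) m = m" if m: "m \<in> carrier M" for m
    proof -
      obtain v where v: "m = \<pi> v" using \<pi>surj[OF m] by blast
      have "sc (\<tau> ^ L) v - v \<in> R" using period(2)[of v] by (simp add: sc.scale_left_diff_distrib)
      then show ?thesis by (simp add: R_diff sc_power v)
    qed
    have "J (r + L) = J r" for r
      unfolding J_def by (rule image_cong) (simp_all add: funpow_add tL)
    then have "b (r + L) = b r" if "r \<ge> 1" for r
      using b[of r] b[of "r + L"] that by (simp add: J_def)
    then show ?thesis using period(1) by blast
  next
    case primes
    have "\<exists>r\<ge>1. card (prime_factors (b r)) \<ge> N" for N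
    proof -
      obtain r P where r: "r \<ge> 1" and P: "finite P" "card P = N"
        "\<And>p. p \<in> P \<Longrightarrow> Factorial_Ring.prime p"
        "\<And>p. p \<in> P \<Longrightarrow> \<exists>v. \<pi> v \<notin> J r \<and> \<pi> (sc [:int p:] v) \<in> J r"
        using primes by metis
      have br: "b r = card (torsion_part (M Mod J r))" using b[OF r] by (simp add: J_def)
      interpret H: comm_group "M Mod J r" by (rule H)
      \<comment> \<open>The torsion part is finite and nonempty, so \<open>b r\<close> is not the
        default cardinality \<open>0\<close>, for which \<open>prime_factors\<close> would be
        empty.\<close>
      have "\<one>\<^bsub>M Mod J r\<^esub> \<in> torsion_part (M Mod J r)"
        using H.one_closed H.nat_pow_one[of 1] unfolding torsion_part_def mem_Collect_eq
        by (metis zero_less_one)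
      then have "b r \<noteq> 0" using fin[OF r] br by auto
      moreover have "p dvd b r" if p: "p \<in> P" for p
      proof -
        obtain v where v: "\<pi> v \<notin> J r" "\<pi> (sc [:int p:] v) \<in> J r" using P(4)[OF p] by blast
        show ?thesis unfolding br
          by (rule prime_dvd_card_torsion_part[OF H fin[OF r] P(3)[OF p] \<kappa>_carrier[of r v]])
            (use v in \<open>simp_all only: \<kappa>_pow \<kappa>_one not_False_eq_True\<close>)
      qed
      ultimately have "P \<subseteq> prime_factors (b r)" using P(3) by (auto simp: in_prime_factors_iff)
      then have "N \<le> card (prime_factors (b r))" using P(2) by (metis card_mono finite_set_mset)
      then show ?thesis using r by blast
    qed
    then show ?thesis by blast
  qed
qed

section \<open>Groups with infinite cyclic abelianization\<close>

text \<open>Here \<open>M\<close> is \<open>K\<close> modulo its commutator subgroup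
  \<open>D\<close>. Finite generation of \<open>M\<close> over Laurent polynomials and surjectivity
  of \<open>t - 1\<close> both come from the crossed homomorphism \<open>\<sigma>\<close>.\<close>

theorem torsion_number_dichotomy:
  fixes G :: "'a monoid" (structure) and \<phi> :: "'a \<Rightarrow> int" and b :: "nat \<Rightarrow> nat"
  assumes G: "group G" and \<phi>: "is_abelianization_int G \<phi>" and x: "x \<in> carrier G" "\<phi> x = 1"
    and F: "finite F" "F \<subseteq> carrier G" "generate G F = carrier G"
    and b: "\<And>r. r \<ge> 1 \<Longrightarrow> b r = torsion_number G \<phi> x r"
  shows "(\<exists>p\<ge>1. \<forall>r\<ge>1. b (r + p) = b r) \<or>
         (\<forall>N::nat. \<exists>r\<ge>1. card (prime_factors (b r)) \<ge> N)"
proof -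
  interpret group G by fact
  define K where "K = kernel G integer_group \<phi>"
  define D where "D = derived G K"
  define M where "M = kernel_ab G \<phi>"
  define t where "t = conj_act G x"
  interpret \<phi>: group_hom G integer_group \<phi>
    by (intro group_hom.intro group_hom_axioms.intro group_axioms group_integer_group)
      (use \<phi> in \<open>simp add: is_abelianization_int_def epi_def\<close>)
  have cancel: "y \<otimes> (inv y \<otimes> z) = z" "inv y \<otimes> (y \<otimes> z) = z" if "y \<in> carrier G" "z \<in> carrier G" for y z
    using that by (simp_all flip: m_assoc)
  have \<phi>_mult: "\<phi> (g \<otimes> h) = \<phi> g + \<phi> h" if "g \<in> carrier G" "h \<in> carrier G" for g h
    using \<phi>.hom_mult[OF that] by simp
  have \<phi>_pow: "\<phi> (x [^] i) = i" for i :: int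
    using \<phi>.hom_int_pow[OF x(1), of i] x(2) by simp
  have K_iff: "g \<in> K \<longleftrightarrow> g \<in> carrier G \<and> \<phi> g = 0" for g
    by (auto simp: K_def kernel_def)
  have K_derived: "K = derived G (carrier G)"
    using \<phi> by (simp add: K_def is_abelianization_int_def)
  interpret K: normal K G
    unfolding K_derived by (rule derived_self_is_normal)
  interpret D: normal D G
    unfolding D_def by (rule derived_is_normal) (rule K.normal_axioms)
  interpret GK: group "G\<lparr>carrier := K\<rparr>"
    by (rule subgroup_imp_group) (rule K.subgroup_axioms)
  have M_eq: "M = G\<lparr>carrier := K\<rparr> Mod D"
    using derived_consistent[OF subset_refl K.subgroup_axioms]
    by (simp add: M_def kernel_ab_def abelianization_def K_def[symmetric] D_def)
  interpret M: comm_group M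
    unfolding M_def kernel_ab_def abelianization_def K_def[symmetric]
    by (rule GK.derived_quot_is_comm_group)
  have coset: "D #>\<^bsub>G\<lparr>carrier := K\<rparr>\<^esub> g = D #> g" for g
    by (simp add: r_coset_def)
  interpret DK: normal D "G\<lparr>carrier := K\<rparr>"
    unfolding D_def by (rule derived_subgroup_is_normal) (rule K.subgroup_axioms)
  have M_carrier: "carrier M = (\<lambda>g. D #> g) ` K"
    by (simp add: M_eq carrier_FactGroup coset)
  have cl_closed: "D #> g \<in> carrier M" if "g \<in> K" for g
    using that by (simp add: M_carrier)
  have cl_mult: "(D #> g) \<otimes>\<^bsub>M\<^esub> (D #> h) = D #> (g \<otimes> h)" if "g \<in> K" "h \<in> K" for g h
    using DK.rcos_sum[of g h] that by (simp add: M_eq coset)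
  have cl_one: "D #> \<one> = \<one>\<^bsub>M\<^esub>"
    by (simp add: M_eq coset_mult_one D.subset)
  have conj_K: "y \<otimes> g \<otimes> inv y \<in> K" if "y \<in> carrier G" "g \<in> K" for y g
    using K.inv_op_closed2 that by blast
  have conj_act_cl: "conj_act G y (D #> g) = D #> (y \<otimes> g \<otimes> inv y)"
    if y: "y \<in> carrier G" and g: "g \<in> carrier G" for y g
  proof
    show "conj_act G y (D #> g) \<subseteq> D #> (y \<otimes> g \<otimes> inv y)"
    proof
      fix z assume "z \<in> conj_act G y (D #> g)"
      then obtain d where d: "d \<in> D" "z = y \<otimes> (d \<otimes> g) \<otimes> inv y"
        by (auto simp: conj_act_def r_coset_def)
      have "z = (y \<otimes> d \<otimes> inv y) \<otimes> (y \<otimes> g \<otimes> inv y)"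
        using d y g subsetD[OF D.subset d(1)] by (simp add: m_assoc cancel)
      moreover have "y \<otimes> d \<otimes> inv y \<in> D" using D.inv_op_closed2 d y by blast
      ultimately show "z \<in> D #> (y \<otimes> g \<otimes> inv y)" by (auto simp: r_coset_def)
    qed
    show "D #> (y \<otimes> g \<otimes> inv y) \<subseteq> conj_act G y (D #> g)"
    proof
      fix z assume "z \<in> D #> (y \<otimes> g \<otimes> inv y)"
      then obtain d where d: "d \<in> D" "z = d \<otimes> (y \<otimes> g \<otimes> inv y)"
        by (auto simp: r_coset_def)
      have "z = y \<otimes> ((inv y \<otimes> d \<otimes> y) \<otimes> g) \<otimes> inv y"
        using d y g subsetD[OF D.subset d(1)] by (simp add: m_assoc cancel)
      moreover have "inv y \<otimes> d \<otimes> y \<in> D" using D.inv_op_closed1 d y by blast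
      ultimately show "z \<in> conj_act G y (D #> g)"
        unfolding conj_act_def r_coset_def by blast
    qed
  qed
  have conj_closed: "conj_act G y m \<in> carrier M" if y: "y \<in> carrier G" and m: "m \<in> carrier M" for y m
  proof -
    obtain g where g: "g \<in> K" "m = D #> g" using m by (auto simp: M_carrier)
    then have "g \<in> carrier G" by (simp add: K_iff)
    then show ?thesis using g y conj_K by (simp add: conj_act_cl cl_closed)
  qed
  have conj_hom: "conj_act G y \<in> hom M M" if y: "y \<in> carrier G" for y
  proof (rule homI)
    show "conj_act G y m \<in> carrier M" if "m \<in> carrier M" for m
      using conj_closed y that by blast
    show "conj_act G y (m \<otimes>\<^bsub>M\<^esub> n) = conj_act G y m \<otimes>\<^bsub>M\<^esub> conj_act G y n"
      if mn: "m \<in> carrier M" "n \<in> carrier M" for m n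
    proof -
      obtain g h where gh: "g \<in> K" "m = D #> g" "h \<in> K" "n = D #> h"
        using mn by (auto simp: M_carrier)
      then have c: "g \<in> carrier G" "h \<in> carrier G" by (simp_all add: K_iff)
      have "y \<otimes> (g \<otimes> h) \<otimes> inv y = (y \<otimes> g \<otimes> inv y) \<otimes> (y \<otimes> h \<otimes> inv y)"
        using c y by (simp add: m_assoc cancel)
      then show ?thesis
        using gh c y by (simp add: cl_mult conj_act_cl conj_K)
    qed
  qed
  have conj_mult: "conj_act G (y \<otimes> z) m = conj_act G y (conj_act G z m)"
    if y: "y \<in> carrier G" and z: "z \<in> carrier G" and m: "m \<in> carrier M" for y z m
  proof -
    obtain g where g: "g \<in> K" "m = D #> g" using m by (auto simp: M_carrier)
    then have c: "g \<in> carrier G" by (simp add: K_iff)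
    show ?thesis
      using g c y z by (simp add: conj_act_cl inv_mult_group m_assoc)
  qed
  have conj_one: "conj_act G \<one> m = m" if m: "m \<in> carrier M" for m
  proof -
    obtain g where g: "g \<in> K" "m = D #> g" using m by (auto simp: M_carrier)
    then have c: "g \<in> carrier G" by (simp add: K_iff)
    show ?thesis using g c by (simp add: conj_act_cl)
  qed
  have t_bij: "bij_betw t (carrier M) (carrier M)"
    unfolding t_def
    by (rule bij_betw_byWitness[where f' = "conj_act G (inv x)"])
      (use x conj_closed in \<open>auto simp: conj_one simp flip: conj_mult\<close>)
  \<comment> \<open>A power of \<open>x\<close> brings \<open>g\<close> into \<open>K\<close>; this
    extends the projection from \<open>K\<close> to \<open>M\<close> to all of \<open>G\<close>, at
    the price of the twist by \<open>t\<close> to the power \<open>\<phi> g\<close> in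
    \<open>\<sigma>_mult\<close>.\<close>
  define \<sigma> where "\<sigma> g = D #> (g \<otimes> x [^] (- \<phi> g))" for g
  have \<sigma>_K: "g \<otimes> x [^] (- \<phi> g) \<in> K" if "g \<in> carrier G" for g
    using that x by (simp add: K_iff \<phi>_mult \<phi>_pow)
  have \<sigma>_closed: "\<sigma> g \<in> carrier M" if "g \<in> carrier G" for g
    unfolding \<sigma>_def using cl_closed \<sigma>_K that by blast
  have \<sigma>_mult: "\<sigma> (g \<otimes> h) = \<sigma> g \<otimes>\<^bsub>M\<^esub> conj_act G (x [^] \<phi> g) (\<sigma> h)"
    if g: "g \<in> carrier G" and h: "h \<in> carrier G" for g h
  proof -
    have "conj_act G (x [^] \<phi> g) (\<sigma> h) = D #> (x [^] \<phi> g \<otimes> (h \<otimes> x [^] (- \<phi> h)) \<otimes> inv (x [^] \<phi> g))"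
      unfolding \<sigma>_def using x h by (simp add: conj_act_cl)
    then have "\<sigma> g \<otimes>\<^bsub>M\<^esub> conj_act G (x [^] \<phi> g) (\<sigma> h) =
        D #> ((g \<otimes> x [^] (- \<phi> g)) \<otimes> (x [^] \<phi> g \<otimes> (h \<otimes> x [^] (- \<phi> h)) \<otimes> inv (x [^] \<phi> g)))"
      using cl_mult[OF \<sigma>_K[OF g] conj_K[OF _ \<sigma>_K[OF h], of "x [^] \<phi> g"]] x by (simp add: \<sigma>_def)
    also have "(g \<otimes> x [^] (- \<phi> g)) \<otimes> (x [^] \<phi> g \<otimes> (h \<otimes> x [^] (- \<phi> h)) \<otimes> inv (x [^] \<phi> g)) =
        g \<otimes> h \<otimes> (x [^] (- \<phi> h) \<otimes> x [^] (- \<phi> g))"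
      using x g h by (simp add: int_pow_neg m_assoc cancel)
    also have "x [^] (- \<phi> h) \<otimes> x [^] (- \<phi> g) = x [^] (- \<phi> (g \<otimes> h))"
      using x g h by (simp add: \<phi>_mult add.commute flip: int_pow_mult)
    finally show ?thesis by (simp add: \<sigma>_def)
  qed
  have \<sigma>_of_K: "\<sigma> g = D #> g" if "g \<in> K" for g
    using that by (simp add: \<sigma>_def K_iff)
  have \<sigma>_one: "\<sigma> \<one> = \<one>\<^bsub>M\<^esub>"
    using \<sigma>_of_K[of \<one>] cl_one by simp
  have T_in: "conj_act G (x [^] i) m \<in> U \<longleftrightarrow> m \<in> U"
    if U: "\<And>m. m \<in> carrier M \<Longrightarrow> t m \<in> U \<longleftrightarrow> m \<in> U" and m: "m \<in> carrier M" for U m and i :: int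
  proof (induction i rule: int_induct[where k = 0])
    case base
    show ?case using conj_one[OF m] by simp
  next
    case (step1 i)
    have "x [^] (i + 1) = x \<otimes> x [^] i"
      using int_pow_mult[OF x(1), of 1 i] x(1) by (simp add: add.commute int_pow_1)
    then have "conj_act G (x [^] (i + 1)) m = t (conj_act G (x [^] i) m)"
      using x m by (simp add: t_def conj_mult)
    then show ?case using step1 U conj_closed x m by simp
  next
    case (step2 i)
    have "x [^] i = x \<otimes> x [^] (i - 1)"
      using int_pow_mult[OF x(1), of 1 "i - 1"] x(1) by (simp add: int_pow_1)
    then have "conj_act G (x [^] i) m = t (conj_act G (x [^] (i - 1)) m)"
      using x m by (simp add: t_def conj_mult)
    then show ?case using step2 U conj_closed x m by simp
  qed
  have gen: "U = carrier M"
    if U: "subgroup U M" and FU: "\<sigma> ` F \<subseteq> U" and tU: "\<And>m. m \<in> carrier M \<Longrightarrow> t m \<in> U \<longleftrightarrow> m \<in> U" for U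
  proof -
    interpret U: subgroup U M by fact
    \<comment> \<open>Stability of \<open>U\<close> under \<open>t\<close> and its inverse absorbs
      the twist in \<open>\<sigma>_mult\<close>. The subgroup contains \<open>F\<close>, hence is
      \<open>G\<close>.\<close>
    have "subgroup {g \<in> carrier G. \<sigma> g \<in> U} G"
    proof (rule subgroupI)
      show "{g \<in> carrier G. \<sigma> g \<in> U} \<noteq> {}" using \<sigma>_one U.one_closed by auto
      show "g \<otimes> h \<in> {g \<in> carrier G. \<sigma> g \<in> U}"
        if "g \<in> {g \<in> carrier G. \<sigma> g \<in> U}" "h \<in> {g \<in> carrier G. \<sigma> g \<in> U}" for g h
        using that \<sigma>_mult T_in[OF tU] \<sigma>_closed U.m_closed by simp
      show "inv g \<in> {g \<in> carrier G. \<sigma> g \<in> U}" if g: "g \<in> {g \<in> carrier G. \<sigma> g \<in> U}" for g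
      proof -
        let ?c = "conj_act G (x [^] \<phi> g) (\<sigma> (inv g))"
        have c: "?c \<in> carrier M" using g x \<sigma>_closed conj_closed by simp
        have "\<sigma> g \<otimes>\<^bsub>M\<^esub> ?c = \<one>\<^bsub>M\<^esub>"
          using \<sigma>_mult[of g "inv g"] g \<sigma>_one by simp
        then have "?c = inv\<^bsub>M\<^esub> \<sigma> g"
          using c g \<sigma>_closed by (metis (no_types, lifting) M.inv_equality M.m_comm mem_Collect_eq)
        then have "?c \<in> U" using g U.m_inv_closed by simp
        then show ?thesis using T_in[OF tU] \<sigma>_closed g by simp
      qed
    qed auto
    then have "generate G F \<subseteq> {g \<in> carrier G. \<sigma> g \<in> U}"
      using F FU by (intro generate_subgroup_incl) auto
    then have "\<sigma> g \<in> U" if "g \<in> carrier G" for g using F that by auto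
    then have "D #> g \<in> U" if "g \<in> K" for g using that \<sigma>_of_K K_iff by metis
    then show ?thesis using U.subset by (auto simp: M_carrier)
  qed
  define J where "J = (\<lambda>m. t m \<otimes>\<^bsub>M\<^esub> inv\<^bsub>M\<^esub> m) ` carrier M"
  have J_sub: "subgroup J M"
    unfolding J_def t_def by (rule M.subgroup_endo_diff[OF conj_hom[OF x(1)]])
  have J_normal: "J \<lhd> M"
    using J_sub by (rule M.normal_iff_subgroup[THEN iffD2])
  interpret J: normal J M by (rule J_normal)
  interpret Q: comm_group "M Mod J" by (rule M.abelian_FactGroup[OF J_sub])
  have Jt: "J #>\<^bsub>M\<^esub> t m = J #>\<^bsub>M\<^esub> m" if m: "m \<in> carrier M" for m
  proof -
    have tm: "t m \<in> carrier M" unfolding t_def using conj_closed x m by blast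
    have "(t m \<otimes>\<^bsub>M\<^esub> inv\<^bsub>M\<^esub> m) \<otimes>\<^bsub>M\<^esub> m \<in> J #>\<^bsub>M\<^esub> m"
      using m by (auto simp: J_def r_coset_def)
    then have "t m \<in> J #>\<^bsub>M\<^esub> m" using m tm by (simp add: M.m_assoc)
    then show ?thesis using M.repr_independence[OF _ m J_sub] by simp
  qed
  have JT: "J #>\<^bsub>M\<^esub> conj_act G (x [^] i) m = J #>\<^bsub>M\<^esub> m" if m: "m \<in> carrier M" for m and i :: int
  proof -
    define U where "U = {n \<in> carrier M. J #>\<^bsub>M\<^esub> n = J #>\<^bsub>M\<^esub> m}"
    have "t n \<in> U \<longleftrightarrow> n \<in> U" if n: "n \<in> carrier M" for n
      using Jt[OF n] conj_closed[OF x(1) n] n by (simp add: U_def t_def)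
    from T_in[OF this m, of i] show ?thesis using m by (simp add: U_def)
  qed
  \<comment> \<open>Modulo \<open>J = (t - 1) M\<close> the twist disappears, so
    \<open>\<sigma>\<close> becomes a homomorphism to an abelian group and kills the commutator
    subgroup \<open>K\<close>. On \<open>K\<close> it is induced by the projection onto
    \<open>M\<close>, whence \<open>J = M\<close>.\<close>
  define \<psi> where "\<psi> g = J #>\<^bsub>M\<^esub> \<sigma> g" for g
  have \<psi>_hom: "\<psi> \<in> hom G (M Mod J)"
  proof (rule homI)
    show "\<psi> g \<in> carrier (M Mod J)" if "g \<in> carrier G" for g
      using \<sigma>_closed[OF that] by (simp add: \<psi>_def carrier_FactGroup)
    show "\<psi> (g \<otimes> h) = \<psi> g \<otimes>\<^bsub>M Mod J\<^esub> \<psi> h" if gh: "g \<in> carrier G" "h \<in> carrier G" for g h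
    proof -
      have c: "conj_act G (x [^] \<phi> g) (\<sigma> h) \<in> carrier M"
        using conj_closed x \<sigma>_closed gh by simp
      show ?thesis
        using J.rcos_sum[OF \<sigma>_closed[OF gh(1)] c] JT[OF \<sigma>_closed[OF gh(2)]] \<sigma>_mult[OF gh]
        by (simp add: \<psi>_def)
    qed
  qed
  interpret \<psi>: group_hom G "M Mod J" \<psi> by unfold_locales (rule \<psi>_hom)
  have derived_le: "derived G (carrier G) \<subseteq> kernel G (M Mod J) \<psi>"
    unfolding derived_def
  proof (rule generate_subgroup_incl[OF _ \<psi>.subgroup_kernel])
    show "derived_set G (carrier G) \<subseteq> kernel G (M Mod J) \<psi>"
    proof clarify
      fix g h assume "g \<in> carrier G" "h \<in> carrier G"
      then show "g \<otimes> h \<otimes> inv g \<otimes> inv h \<in> kernel G (M Mod J) \<psi>"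
        unfolding kernel_def mem_Collect_eq
        by (simp add: Q.m_ac Q.r_inv del: mult_FactGroup one_FactGroup)
          (metis Q.m_lcomm Q.r_inv Q.r_one \<psi>.hom_closed Q.inv_closed)
    qed
  qed
  have surj: "m \<in> J" if m: "m \<in> carrier M" for m
  proof -
    obtain g where g: "g \<in> K" "m = D #> g" using m by (auto simp: M_carrier)
    have "\<psi> g = \<one>\<^bsub>M Mod J\<^esub>" using derived_le g by (auto simp: K_derived kernel_def)
    then have "J #>\<^bsub>M\<^esub> m = J" using \<sigma>_of_K g by (simp add: \<psi>_def)
    then show ?thesis using M.coset_join1[OF _ m J_sub] by simp
  qed
  show ?thesis
  proof (rule comm_group_torsion_dichotomy[OF M.comm_group_axioms, of t "\<sigma> ` F"])
    show "t \<in> hom M M" unfolding t_def by (rule conj_hom[OF x(1)])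
    show "bij_betw t (carrier M) (carrier M)" by (rule t_bij)
    show "finite (\<sigma> ` F)" "\<sigma> ` F \<subseteq> carrier M" using F \<sigma>_closed by auto
    show "U = carrier M" if "subgroup U M" "\<sigma> ` F \<subseteq> U" "\<And>m. m \<in> carrier M \<Longrightarrow> t m \<in> U \<longleftrightarrow> m \<in> U" for U
      using gen that by blast
    show "\<exists>m'\<in>carrier M. m = t m' \<otimes>\<^bsub>M\<^esub> inv\<^bsub>M\<^esub> m'" if "m \<in> carrier M" for m
      using surj[OF that] by (auto simp: J_def)
    show "b r = card (torsion_part (M Mod (\<lambda>m. (t ^^ r) m \<otimes>\<^bsub>M\<^esub> inv\<^bsub>M\<^esub> m) ` carrier M))" if "r \<ge> 1" for r
      using b[OF that]
      by (simp add: torsion_number_def cyclic_quotient_def power_minus_one_image_def M_def t_def)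
  qed
qed

section \<open>Finitely generated fundamental groups\<close>

definition finitely_generated :: "('a, 'b) monoid_scheme \<Rightarrow> bool" where
  "finitely_generated G \<longleftrightarrow> (\<exists>F. finite F \<and> F \<subseteq> carrier G \<and> generate G F = carrier G)"

section \<open>Path classes and holonomy\<close>

lemma path_class_eqD:
  assumes "path_class S p = path_class S q" "path p" "path_image p \<subseteq> S"
  shows "homotopic_paths S p q"
proof -
  have "p \<in> path_class S p" using assms(2,3) by (simp add: path_class_def)
  then have "p \<in> path_class S q" using assms(1) by simp
  then have "homotopic_paths S q p" by (simp add: path_class_def)
  then show ?thesis by (rule homotopic_paths_sym)
qed

lemma carrier_fundamental_group: "carrier (fundamental_group S a) = path_class S ` based_loops S a"
  by (simp add: fundamental_group_def)

lemma one_fundamental_group: "\<one>\<^bsub>fundamental_group S a\<^esub> = path_class S (linepath a a)"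
  by (simp add: fundamental_group_def)

lemma finitely_generated_simply_connected:
  assumes "simply_connected S" "a \<in> S"
  shows "finitely_generated (fundamental_group S a)"
proof -
  interpret group "fundamental_group S a" by (rule group_fundamental_group) fact
  have "carrier (fundamental_group S a) = {\<one>\<^bsub>fundamental_group S a\<^esub>}"
  proof -
    have "path_class S p = path_class S (linepath a a)" if "p \<in> based_loops S a" for p
      using that assms unfolding simply_connected_eq_contractible_path
      by (intro path_class_eqI) (auto simp: based_loops_def)
    then show ?thesis
      using one_closed by (auto simp: carrier_fundamental_group one_fundamental_group)
  qed
  then show ?thesis
    unfolding finitely_generated_def by (intro exI[of _ "{}"]) (simp add: generate_empty)
qed

text \<open>A choice of paths \<open>\<eta>\<close> from the base point turns every path of \<open>S\<close>
  into an element of the fundamental group, functorially.\<close>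

locale path_family =
  fixes S :: "'a::real_normed_vector set" and a :: 'a and \<eta> :: "'a \<Rightarrow> real \<Rightarrow> 'a"
  assumes base: "a \<in> S"
    and \<eta>: "y \<in> S \<Longrightarrow> path (\<eta> y)" "y \<in> S \<Longrightarrow> path_image (\<eta> y) \<subseteq> S"
      "y \<in> S \<Longrightarrow> pathstart (\<eta> y) = a" "y \<in> S \<Longrightarrow> pathfinish (\<eta> y) = y"
begin

abbreviation Q where "Q \<equiv> fundamental_group S a"

sublocale group Q
  using base by (rule group_fundamental_group)

definition holonomy :: "(real \<Rightarrow> 'a) \<Rightarrow> (real \<Rightarrow> 'a) set" where
  "holonomy q = path_class S (\<eta> (pathstart q) +++ (q +++ reversepath (\<eta> (pathfinish q))))"

lemma endpoints_in:
  assumes "path_image q \<subseteq> S"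
  shows "pathstart q \<in> S" "pathfinish q \<in> S"
  using assms by (auto simp: pathstart_in_path_image pathfinish_in_path_image subset_iff)

lemma holonomy_loop:
  assumes "path q" "path_image q \<subseteq> S"
  shows "\<eta> (pathstart q) +++ (q +++ reversepath (\<eta> (pathfinish q))) \<in> based_loops S a"
  using assms \<eta> endpoints_in[OF assms(2)] by (simp add: based_loops_def path_image_join)

lemma holonomy_closed:
  assumes "path q" "path_image q \<subseteq> S"
  shows "holonomy q \<in> carrier Q"
  unfolding holonomy_def carrier_fundamental_group by (rule imageI) (rule holonomy_loop[OF assms])

lemma holonomy_cong:
  assumes "homotopic_paths S q r"
  shows "holonomy q = holonomy r"
proof -
  have q: "path q" "path_image q \<subseteq> S" and r: "path r" "path_image r \<subseteq> S"
    and eq: "pathstart q = pathstart r" "pathfinish q = pathfinish r"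
    using assms homotopic_paths_imp_path homotopic_paths_imp_subset
      homotopic_paths_imp_pathstart homotopic_paths_imp_pathfinish by blast+
  show ?thesis
    unfolding holonomy_def eq
    using q r eq \<eta> endpoints_in[OF r(2)] assms
    by (intro path_class_eqI homotopic_paths_join) auto
qed

lemma holonomy_join:
  assumes q: "path q" "path_image q \<subseteq> S" and r: "path r" "path_image r \<subseteq> S"
    and qr: "pathfinish q = pathstart r"
  shows "holonomy (q +++ r) = holonomy q \<otimes>\<^bsub>Q\<^esub> holonomy r"
proof -
  define A B C where "A = \<eta> (pathstart q)" and "B = \<eta> (pathstart r)" and "C = \<eta> (pathfinish r)"
  note paths = endpoints_in[OF q(2)] endpoints_in[OF r(2)]
  have A: "path A" "path_image A \<subseteq> S" "pathstart A = a" "pathfinish A = pathstart q"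
    and B: "path B" "path_image B \<subseteq> S" "pathstart B = a" "pathfinish B = pathstart r"
    and C: "path C" "path_image C \<subseteq> S" "pathstart C = a" "pathfinish C = pathfinish r"
    using \<eta> paths by (simp_all add: A_def B_def C_def)
  note simps = A B C q r qr path_image_join
  let ?h = "homotopic_paths S"
  let ?RC = "r +++ reversepath C"
  have 1: "?h ((A +++ (q +++ reversepath B)) +++ (B +++ ?RC)) (A +++ ((q +++ reversepath B) +++ (B +++ ?RC)))"
    by (intro homotopic_paths_sym[OF homotopic_paths_assoc]) (simp_all add: simps)
  have 2: "?h ((q +++ reversepath B) +++ (B +++ ?RC)) (q +++ (reversepath B +++ (B +++ ?RC)))"
    by (intro homotopic_paths_sym[OF homotopic_paths_assoc]) (simp_all add: simps)
  have 3: "?h (reversepath B +++ (B +++ ?RC)) ((reversepath B +++ B) +++ ?RC)"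
    by (intro homotopic_paths_assoc) (simp_all add: simps)
  have 4: "?h ((reversepath B +++ B) +++ ?RC) (linepath (pathfinish B) (pathfinish B) +++ ?RC)"
    by (intro homotopic_paths_join homotopic_paths_linv) (simp_all add: simps)
  have 5: "?h (linepath (pathfinish B) (pathfinish B) +++ ?RC) ?RC"
    by (rule homotopic_paths_lid') (simp_all add: simps)
  have 6: "?h (q +++ (reversepath B +++ (B +++ ?RC))) (q +++ ?RC)"
    by (intro homotopic_paths_join homotopic_paths_trans[OF 3 homotopic_paths_trans[OF 4 5]])
      (simp_all add: simps)
  have 7: "?h (q +++ ?RC) ((q +++ r) +++ reversepath C)"
    by (intro homotopic_paths_assoc) (simp_all add: simps)
  have 8: "?h (A +++ ((q +++ reversepath B) +++ (B +++ ?RC))) (A +++ ((q +++ r) +++ reversepath C))"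
    by (intro homotopic_paths_join homotopic_paths_trans[OF 2 homotopic_paths_trans[OF 6 7]])
      (simp_all add: simps)
  have "path_class S ((A +++ (q +++ reversepath B)) +++ (B +++ ?RC)) =
      path_class S (A +++ ((q +++ r) +++ reversepath C))"
    by (rule path_class_eqI) (rule homotopic_paths_trans[OF 1 8])
  moreover have "holonomy (q +++ r) = path_class S (A +++ ((q +++ r) +++ reversepath C))"
    by (simp add: holonomy_def A_def C_def)
  moreover have "holonomy q \<otimes>\<^bsub>Q\<^esub> holonomy r =
      path_class S ((A +++ (q +++ reversepath B)) +++ (B +++ ?RC))"
    using fundamental_group_mult[OF holonomy_loop[OF q] holonomy_loop[OF r]]
    by (simp add: holonomy_def A_def B_def C_def qr)
  ultimately show ?thesis by simp
qed

lemma holonomy_const: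
  assumes "y \<in> S"
  shows "holonomy (linepath y y) = \<one>\<^bsub>Q\<^esub>"
proof -
  have l: "path (linepath y y)" "path_image (linepath y y) \<subseteq> S" using assms by auto
  have "holonomy (linepath y y) = holonomy (linepath y y +++ linepath y y)"
    using l by (intro holonomy_cong homotopic_paths_sym[OF homotopic_paths_lid']) auto
  also have "\<dots> = holonomy (linepath y y) \<otimes>\<^bsub>Q\<^esub> holonomy (linepath y y)"
    by (rule holonomy_join) (use l in auto)
  finally show ?thesis
    using holonomy_closed[OF l] by (metis l_cancel_one)
qed

lemma holonomy_reverse:
  assumes q: "path q" "path_image q \<subseteq> S"
  shows "holonomy (reversepath q) = inv\<^bsub>Q\<^esub> holonomy q"
proof -
  have "holonomy (reversepath q) \<otimes>\<^bsub>Q\<^esub> holonomy q = holonomy (reversepath q +++ q)"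
    by (rule holonomy_join[symmetric]) (use q in auto)
  also have "\<dots> = holonomy (linepath (pathfinish q) (pathfinish q))"
    by (rule holonomy_cong) (rule homotopic_paths_linv[OF q])
  also have "\<dots> = \<one>\<^bsub>Q\<^esub>"
    by (rule holonomy_const) (rule endpoints_in[OF q(2)])
  finally show ?thesis
    using holonomy_closed q by (intro inv_equality[symmetric]) auto
qed

text \<open>\<open>\<eta> a\<close> may be any loop at \<open>a\<close>, so on based loops holonomy
  is the class only up to conjugation.\<close>

lemma holonomy_based:
  assumes p: "p \<in> based_loops S a"
  shows "holonomy p = path_class S (\<eta> a) \<otimes>\<^bsub>Q\<^esub> path_class S p \<otimes>\<^bsub>Q\<^esub> inv\<^bsub>Q\<^esub> path_class S (\<eta> a)"
proof -
  have e: "\<eta> a \<in> based_loops S a" using \<eta> base by (simp add: based_loops_def)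
  then have re: "reversepath (\<eta> a) \<in> based_loops S a" by (simp add: based_loops_def)
  have pre: "p +++ reversepath (\<eta> a) \<in> based_loops S a"
    using p re by (auto simp: based_loops_def path_image_join)
  have "path_class S (reversepath (\<eta> a)) \<otimes>\<^bsub>Q\<^esub> path_class S (\<eta> a) = \<one>\<^bsub>Q\<^esub>"
    unfolding fundamental_group_mult[OF re e] one_fundamental_group
    using e homotopic_paths_linv[of "\<eta> a" S] by (intro path_class_eqI) (auto simp: based_loops_def)
  then have inv: "inv\<^bsub>Q\<^esub> path_class S (\<eta> a) = path_class S (reversepath (\<eta> a))"
    using e re by (intro inv_equality) (auto simp: carrier_fundamental_group)
  have "holonomy p = path_class S (\<eta> a +++ (p +++ reversepath (\<eta> a)))"
    using p by (simp add: holonomy_def based_loops_def)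
  also have "\<dots> = path_class S (\<eta> a) \<otimes>\<^bsub>Q\<^esub> (path_class S p \<otimes>\<^bsub>Q\<^esub> path_class S (reversepath (\<eta> a)))"
    by (simp add: fundamental_group_mult e re p pre)
  finally show ?thesis
    using e p re by (simp add: inv m_assoc carrier_fundamental_group)
qed

text \<open>Connectedness of the unit interval replaces the usual subdivision of a loop into paths
  subordinate to the cover.\<close>

lemma local_paths_generate:
  assumes H: "subgroup H Q" and w: "\<And>y. y \<in> S \<Longrightarrow> w y \<in> carrier Q"
    and cover: "\<And>y. y \<in> S \<Longrightarrow> \<exists>U. openin (top_of_set S) U \<and> y \<in> U \<and>
      (\<forall>q. path q \<and> path_image q \<subseteq> U \<longrightarrow>
        inv\<^bsub>Q\<^esub> w (pathstart q) \<otimes>\<^bsub>Q\<^esub> holonomy q \<otimes>\<^bsub>Q\<^esub> w (pathfinish q) \<in> H)"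
  shows "H = carrier Q"
proof -
  interpret H: subgroup H Q by fact
  \<comment> \<open>Holonomy corrected by \<open>w\<close> at both ends; on concatenations the inner
    corrections cancel.\<close>
  define D where "D q = inv\<^bsub>Q\<^esub> w (pathstart q) \<otimes>\<^bsub>Q\<^esub> holonomy q \<otimes>\<^bsub>Q\<^esub> w (pathfinish q)" for q
  have D_join: "D (q +++ r) = D q \<otimes>\<^bsub>Q\<^esub> D r"
    if "path q" "path_image q \<subseteq> S" "path r" "path_image r \<subseteq> S" "pathfinish q = pathstart r" for q r
  proof -
    have c: "w (pathstart q) \<in> carrier Q" "w (pathstart r) \<in> carrier Q" "w (pathfinish r) \<in> carrier Q"
        "holonomy q \<in> carrier Q" "holonomy r \<in> carrier Q"
      using that w endpoints_in holonomy_closed by auto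
    have "w (pathstart r) \<otimes>\<^bsub>Q\<^esub> (inv\<^bsub>Q\<^esub> w (pathstart r) \<otimes>\<^bsub>Q\<^esub> z) = z" if "z \<in> carrier Q" for z
      using c that by (simp flip: m_assoc)
    then show ?thesis
      using that c by (simp add: D_def holonomy_join m_assoc)
  qed
  have cover_D: "\<exists>U. openin (top_of_set S) U \<and> y \<in> U \<and> (\<forall>q. path q \<and> path_image q \<subseteq> U \<longrightarrow> D q \<in> H)"
    if "y \<in> S" for y
    using cover[OF that] by (simp only: D_def)
  have D_cong: "D q = D r" if "homotopic_paths S q r" for q r
    using that holonomy_cong[OF that] homotopic_paths_imp_pathstart homotopic_paths_imp_pathfinish
    unfolding D_def by metis
  have D_loop: "D p \<in> H" if p: "p \<in> based_loops S a" for p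
  proof -
    have path: "path p" "path_image p \<subseteq> S" using p by (auto simp: based_loops_def)
    have sub: "path (subpath s t p)" "path_image (subpath s t p) \<subseteq> S"
      if "s \<in> {0..1}" "t \<in> {0..1}" for s t
      using that path path_image_subpath_subset by (auto simp: path_subpath) blast
    have D_trans: "D (subpath s u p) = D (subpath s t p) \<otimes>\<^bsub>Q\<^esub> D (subpath t u p)"
      if "s \<in> {0..1}" "t \<in> {0..1}" "u \<in> {0..1}" for s t u
    proof -
      have "homotopic_paths S (subpath s t p +++ subpath t u p) (subpath s u p)"
        using that path by (intro homotopic_join_subpaths)
      then have "D (subpath s u p) = D (subpath s t p +++ subpath t u p)"
        by (rule D_cong[symmetric])
      also have "\<dots> = D (subpath s t p) \<otimes>\<^bsub>Q\<^esub> D (subpath t u p)"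
        using sub[OF that(1,2)] sub[OF that(2,3)] by (intro D_join) simp_all
      finally show ?thesis .
    qed
    have D_closed: "D (subpath s t p) \<in> carrier Q" if "s \<in> {0..1}" "t \<in> {0..1}" for s t
      unfolding D_def by (intro m_closed inv_closed w holonomy_closed endpoints_in sub[OF that])
    have D_refl: "D (subpath s s p) = \<one>\<^bsub>Q\<^esub>" if "s \<in> {0..1}" for s
      using D_trans[OF that that that] D_closed[OF that that] by (metis l_cancel_one)
    have D_sym: "D (subpath t s p) = inv\<^bsub>Q\<^esub> D (subpath s t p)" if "s \<in> {0..1}" "t \<in> {0..1}" for s t
      using D_trans[OF that(2,1,2)] D_refl[OF that(2)] D_closed that
      by (intro inv_equality[symmetric]) auto
    have "D (subpath 0 1 p) \<in> H"
    \<comment> \<open>Two parameters are related when \<open>D\<close> of the piece of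
      \<open>p\<close> between them lies in \<open>H\<close>. The cover relates each parameter to
      all nearby ones, so connectedness relates \<open>0\<close> to \<open>1\<close>.\<close>
    proof (rule connected_equivalence_relation[of "{0..1::real}" 0 1 "\<lambda>s t. D (subpath s t p) \<in> H"])
      show "D (subpath t s p) \<in> H" if "D (subpath s t p) \<in> H" "s \<in> {0..1}" "t \<in> {0..1}" for s t
        by (subst D_sym[OF that(2,3)]) (rule H.m_inv_closed[OF that(1)])
      show "D (subpath s u p) \<in> H" if "D (subpath s t p) \<in> H" "D (subpath t u p) \<in> H"
        "s \<in> {0..1}" "t \<in> {0..1}" "u \<in> {0..1}" for s t u
        by (subst D_trans[OF that(3,4,5)]) (rule H.m_closed[OF that(1,2)])
      show "\<exists>T. openin (top_of_set {0..1}) T \<and> s \<in> T \<and> (\<forall>t\<in>T. D (subpath s t p) \<in> H)"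
        if s: "s \<in> {0..1}" for s
      proof -
        have "p s \<in> S" using path s by (auto simp: path_image_def)
        then obtain U where U: "openin (top_of_set S) U" "p s \<in> U"
            "\<And>q. path q \<Longrightarrow> path_image q \<subseteq> U \<Longrightarrow> D q \<in> H"
          using cover_D by meson
        have cont: "continuous_on {0..1} p" using path by (simp add: path_def)
        obtain V where V: "open V" "U = S \<inter> V" using U(1) by (auto simp: openin_open)
        obtain e where e: "e > 0" "\<And>t. t \<in> {0..1} \<Longrightarrow> dist t s < e \<Longrightarrow> p t \<in> V"
        proof -
          have "openin (top_of_set {0..1}) ({0..1} \<inter> p -` V)"
            using cont V(1) by (rule continuous_openin_preimage_gen)
          then obtain W where W: "open W" "{0..1} \<inter> p -` V = {0..1} \<inter> W" by (auto simp: openin_open)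
          have "s \<in> {0..1} \<inter> p -` V" using s U(2) V(2) by simp
          then have "s \<in> W" using W(2) by blast
          then obtain e where "e > 0" "ball s e \<subseteq> W" using W(1) open_contains_ball by blast
          have *: "p t \<in> V" if "t \<in> {0..1}" "dist t s < e" for t
          proof -
            have "t \<in> W" using that \<open>ball s e \<subseteq> W\<close> by (auto simp: subset_iff dist_commute)
            then have "t \<in> {0..1} \<inter> p -` V" using W(2) that(1) by blast
            then show ?thesis by simp
          qed
          show ?thesis by (rule that[OF \<open>e > 0\<close> *])
        qed
        have "D (subpath s t p) \<in> H" if t: "t \<in> {0..1}" "dist t s < e" for t
        proof (rule U(3))
          show "path (subpath s t p)" using sub s t by blast
          have "p u \<in> U" if "u \<in> closed_segment s t" for u
          proof -
            have "u \<in> {0..1}" using that s t closed_segment_subset[of s "{0..1}" t] by auto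
            moreover have "dist u s < e"
              using that t dist_in_closed_segment[of u s t] by (simp add: dist_commute)
            ultimately show ?thesis
              using e(2) V(2) path by (auto simp: path_image_def)
          qed
          then show "path_image (subpath s t p) \<subseteq> U"
            by (auto simp: path_image_subpath_gen)
        qed
        then show ?thesis
          using s e(1) by (intro exI[of _ "{0..1} \<inter> ball s e"]) (auto simp: dist_commute openin_open)
      qed
    qed auto
    then show ?thesis by simp
  qed
  have wa: "w a \<in> carrier Q" and ea: "path_class S (\<eta> a) \<in> carrier Q"
    using w base \<eta> by (auto simp: carrier_fundamental_group based_loops_def)
  \<comment> \<open>\<open>D p\<close> is the conjugate of the class of \<open>p\<close> by
    \<open>k\<close>, so every \<open>g\<close> is \<open>D p\<close> for a loop \<open>p\<close> in
    the class of \<open>g\<close> conjugated by the inverse of \<open>k\<close>.\<close>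
  define k where "k = inv\<^bsub>Q\<^esub> w a \<otimes>\<^bsub>Q\<^esub> path_class S (\<eta> a)"
  have k: "k \<in> carrier Q" using wa ea by (simp add: k_def)
  have "g \<in> H" if g: "g \<in> carrier Q" for g
  proof -
    have "inv\<^bsub>Q\<^esub> k \<otimes>\<^bsub>Q\<^esub> g \<otimes>\<^bsub>Q\<^esub> k \<in> carrier Q" using k g by simp
    then obtain p where p: "p \<in> based_loops S a" "path_class S p = inv\<^bsub>Q\<^esub> k \<otimes>\<^bsub>Q\<^esub> g \<otimes>\<^bsub>Q\<^esub> k"
      by (metis carrier_fundamental_group imageE)
    have pc: "path_class S p \<in> carrier Q" using p(1) by (simp add: carrier_fundamental_group)
    have "D p = k \<otimes>\<^bsub>Q\<^esub> path_class S p \<otimes>\<^bsub>Q\<^esub> inv\<^bsub>Q\<^esub> k"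
      unfolding D_def holonomy_based[OF p(1)] k_def
      using p(1) pc wa ea by (simp add: based_loops_def m_assoc inv_mult_group)
    also have "\<dots> = g"
    proof -
      have "k \<otimes>\<^bsub>Q\<^esub> (inv\<^bsub>Q\<^esub> k \<otimes>\<^bsub>Q\<^esub> z) = z" if "z \<in> carrier Q" for z
        using k that by (simp flip: m_assoc)
      then show ?thesis using k g by (simp add: p(2) m_assoc)
    qed
    finally show ?thesis using D_loop[OF p(1)] by simp
  qed
  then show ?thesis using H.subset by blast
qed

end

text \<open>Classes in \<open>U\<close> and in \<open>S\<close> are different sets of paths, so the
  inclusion is followed on representatives: the induction along \<open>generate\<close> treats every
  loop that represents a generated class.\<close>

lemma (in path_family) holonomy_in_generated:
  assumes U: "U \<subseteq> S" "c \<in> U" and L: "L \<subseteq> based_loops U c"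
    and gen: "generate (fundamental_group U c) (path_class U ` L) = carrier (fundamental_group U c)"
    and H: "subgroup H Q" "holonomy ` L \<subseteq> H" and l: "l \<in> based_loops U c"
  shows "holonomy l \<in> H"
proof -
  interpret U: group "fundamental_group U c" by (rule group_fundamental_group) (rule U)
  interpret H: subgroup H Q by fact
  have loopD: "path l" "path_image l \<subseteq> U" "path_image l \<subseteq> S" "pathstart l = c" "pathfinish l = c"
    if "l \<in> based_loops U c" for l
    using that U by (auto simp: based_loops_def)
  have same: "holonomy l = holonomy l'" if "path_class U l = path_class U l'" "l \<in> based_loops U c" for l l'
    using path_class_eqD[OF that(1)] loopD[OF that(2)] U(1)
    by (intro holonomy_cong) (auto intro: homotopic_paths_subset)
  have join: "l +++ l' \<in> based_loops U c" "holonomy (l +++ l') = holonomy l \<otimes>\<^bsub>Q\<^esub> holonomy l'"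
    if "l \<in> based_loops U c" "l' \<in> based_loops U c" for l l'
  proof -
    show "l +++ l' \<in> based_loops U c"
      using loopD[OF that(1)] loopD[OF that(2)] by (simp add: based_loops_def path_image_join)
    show "holonomy (l +++ l') = holonomy l \<otimes>\<^bsub>Q\<^esub> holonomy l'"
      using loopD[OF that(1)] loopD[OF that(2)] by (intro holonomy_join) auto
  qed
  have "\<forall>l\<in>based_loops U c. A = path_class U l \<longrightarrow> holonomy l \<in> H"
    if "A \<in> generate (fundamental_group U c) (path_class U ` L)" for A
    using that
  proof (induction A rule: generate.induct)
    case one
    show ?case
    proof (intro ballI impI)
      fix l assume l: "l \<in> based_loops U c" "\<one>\<^bsub>fundamental_group U c\<^esub> = path_class U l"
      then have "holonomy l = holonomy (linepath c c)"
        by (intro same) (simp_all add: one_fundamental_group)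
      then show "holonomy l \<in> H" using holonomy_const U by auto
    qed
  next
    case (incl A)
    then obtain l0 where l0: "l0 \<in> L" "A = path_class U l0" by blast
    then show ?case using same[of _ l0] H(2) by auto
  next
    case (inv A)
    then obtain l0 where l0: "l0 \<in> L" "A = path_class U l0" by blast
    then have l0': "l0 \<in> based_loops U c" using L by blast
    show ?case
    proof (intro ballI impI)
      fix l assume l: "l \<in> based_loops U c" "inv\<^bsub>fundamental_group U c\<^esub> A = path_class U l"
      have "A \<in> carrier (fundamental_group U c)" using l0 l0' by (simp add: carrier_fundamental_group)
      then have "path_class U l \<otimes>\<^bsub>fundamental_group U c\<^esub> path_class U l0 = \<one>\<^bsub>fundamental_group U c\<^esub>"
        using l(2) l0 by (metis U.l_inv)
      then have "path_class U (l +++ l0) = path_class U (linepath c c)"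
        by (simp add: fundamental_group_mult[OF l(1) l0'] one_fundamental_group)
      then have "holonomy l \<otimes>\<^bsub>Q\<^esub> holonomy l0 = \<one>\<^bsub>Q\<^esub>"
        using same[of "l +++ l0" "linepath c c"] join[OF l(1) l0'] holonomy_const U by auto
      then have "holonomy l = inv\<^bsub>Q\<^esub> holonomy l0"
        using loopD[OF l(1)] loopD[OF l0'] holonomy_closed by (intro inv_equality[symmetric]) auto
      then show "holonomy l \<in> H" using H.m_inv_closed H(2) l0(1) by auto
    qed
  next
    case (eng A1 A2)
    then have "A1 \<in> path_class U ` based_loops U c" "A2 \<in> path_class U ` based_loops U c"
      unfolding gen carrier_fundamental_group by blast+
    then obtain l1 l2 where l12: "l1 \<in> based_loops U c" "A1 = path_class U l1"
        "l2 \<in> based_loops U c" "A2 = path_class U l2" by blast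
    show ?case
    proof (intro ballI impI)
      fix l assume l: "l \<in> based_loops U c" "A1 \<otimes>\<^bsub>fundamental_group U c\<^esub> A2 = path_class U l"
      then have "path_class U l = path_class U (l1 +++ l2)"
        using fundamental_group_mult[OF l12(1,3)] l12 by simp
      then have "holonomy l = holonomy l1 \<otimes>\<^bsub>Q\<^esub> holonomy l2"
        using same[OF _ l(1)] join(2)[OF l12(1,3)] by simp
      then show "holonomy l \<in> H" using eng.IH l12 by simp
    qed
  qed
  then show ?thesis
    using l unfolding gen carrier_fundamental_group by blast
qed

text \<open>The generation half of the Seifert-van Kampen theorem. Generators are the holonomies of
  loops generating the groups of the pieces, together with one path
  \<open>\<alpha> e +++ \<beta> e\<close> between base points, through the intersection, for each
  pair \<open>e\<close> of meeting pieces.\<close>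

theorem finitely_generated_cover:
  fixes S :: "'a::real_normed_vector set" and U :: "'i \<Rightarrow> 'a set"
  assumes I: "finite I" and S_eq: "S = (\<Union>i\<in>I. U i)"
    and op: "\<And>i. i \<in> I \<Longrightarrow> openin (top_of_set S) (U i)"
    and pc: "\<And>i j. i \<in> I \<Longrightarrow> j \<in> I \<Longrightarrow> path_connected (U i \<inter> U j)"
    and fg: "\<And>i c. i \<in> I \<Longrightarrow> c \<in> U i \<Longrightarrow> finitely_generated (fundamental_group (U i) c)"
    and S: "path_connected S" and a: "a \<in> S"
  shows "finitely_generated (fundamental_group S a)"
proof -
  have "\<forall>y\<in>S. \<exists>g. path g \<and> path_image g \<subseteq> S \<and> pathstart g = a \<and> pathfinish g = y"
    using S a by (simp add: path_connected_def)
  then obtain \<eta> where \<eta>: "\<forall>y\<in>S. path (\<eta> y) \<and> path_image (\<eta> y) \<subseteq> S \<and> pathstart (\<eta> y) = a \<and> pathfinish (\<eta> y) = y"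
    by metis
  interpret path_family S a \<eta>
    by unfold_locales (use a \<eta> in auto)
  define J where "J = {i \<in> I. U i \<noteq> {}}"
  have J: "finite J" using I by (simp add: J_def)
  have US: "U i \<subseteq> S" if "i \<in> J" for i using that S_eq by (auto simp: J_def)
  have "\<forall>i\<in>J. \<exists>c. c \<in> U i" by (auto simp: J_def)
  then obtain c where c: "\<And>i. i \<in> J \<Longrightarrow> c i \<in> U i" by metis
  have path_in: "\<exists>g. path g \<and> path_image g \<subseteq> U i \<inter> U j \<and> pathstart g = u \<and> pathfinish g = v"
    if "i \<in> J" "j \<in> J" "u \<in> U i \<inter> U j" "v \<in> U i \<inter> U j" for i j u v
    using pc[of i j] that unfolding path_connected_def by (simp add: J_def)
  have path_in1: "\<exists>g. path g \<and> path_image g \<subseteq> U i \<and> pathstart g = u \<and> pathfinish g = v"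
    if "i \<in> J" "u \<in> U i" "v \<in> U i" for i u v
    using path_in[of i i u v] that by simp
  have "\<forall>i\<in>J. \<exists>L. finite L \<and> L \<subseteq> based_loops (U i) (c i) \<and>
      generate (fundamental_group (U i) (c i)) (path_class (U i) ` L) = carrier (fundamental_group (U i) (c i))"
  proof
    fix i assume i: "i \<in> J"
    then obtain F where F: "finite F" "F \<subseteq> path_class (U i) ` based_loops (U i) (c i)"
        "generate (fundamental_group (U i) (c i)) F = carrier (fundamental_group (U i) (c i))"
      using fg[of i "c i"] c[OF i] by (auto simp: J_def finitely_generated_def carrier_fundamental_group)
    then show "\<exists>L. finite L \<and> L \<subseteq> based_loops (U i) (c i) \<and>
      generate (fundamental_group (U i) (c i)) (path_class (U i) ` L) = carrier (fundamental_group (U i) (c i))"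
      using finite_subset_image[OF F(1,2)] by metis
  qed
  then obtain L where L: "\<And>i. i \<in> J \<Longrightarrow> finite (L i)" "\<And>i. i \<in> J \<Longrightarrow> L i \<subseteq> based_loops (U i) (c i)"
    "\<And>i. i \<in> J \<Longrightarrow> generate (fundamental_group (U i) (c i)) (path_class (U i) ` L i) =
      carrier (fundamental_group (U i) (c i))"
    by metis
  define E where "E = {(i, j). i \<in> J \<and> j \<in> J \<and> U i \<inter> U j \<noteq> {}}"
  have E: "finite E" by (rule finite_subset[of _ "J \<times> J"]) (use J in \<open>auto simp: E_def\<close>)
  have "\<forall>e\<in>E. \<exists>\<alpha> \<beta>. path \<alpha> \<and> path_image \<alpha> \<subseteq> U (fst e) \<and> pathstart \<alpha> = c (fst e) \<and>
      pathfinish \<alpha> \<in> U (fst e) \<inter> U (snd e) \<and>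
      path \<beta> \<and> path_image \<beta> \<subseteq> U (snd e) \<and> pathstart \<beta> = pathfinish \<alpha> \<and> pathfinish \<beta> = c (snd e)"
  proof
    fix e assume "e \<in> E"
    then obtain i j z where ij: "e = (i, j)" "i \<in> J" "j \<in> J" "z \<in> U i \<inter> U j" by (auto simp: E_def)
    then show "\<exists>\<alpha> \<beta>. path \<alpha> \<and> path_image \<alpha> \<subseteq> U (fst e) \<and> pathstart \<alpha> = c (fst e) \<and>
      pathfinish \<alpha> \<in> U (fst e) \<inter> U (snd e) \<and>
      path \<beta> \<and> path_image \<beta> \<subseteq> U (snd e) \<and> pathstart \<beta> = pathfinish \<alpha> \<and> pathfinish \<beta> = c (snd e)"
      using path_in1[of i "c i" z] path_in1[of j z "c j"] c by fastforce
  qed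
  then obtain \<alpha> \<beta> where \<alpha>\<beta>: "\<forall>e\<in>E. path (\<alpha> e) \<and> path_image (\<alpha> e) \<subseteq> U (fst e) \<and> pathstart (\<alpha> e) = c (fst e) \<and>
      pathfinish (\<alpha> e) \<in> U (fst e) \<inter> U (snd e) \<and>
      path (\<beta> e) \<and> path_image (\<beta> e) \<subseteq> U (snd e) \<and> pathstart (\<beta> e) = pathfinish (\<alpha> e) \<and> pathfinish (\<beta> e) = c (snd e)"
    by metis
  define gens where "gens = (\<Union>i\<in>J. holonomy ` L i) \<union> (\<lambda>e. holonomy (\<alpha> e +++ \<beta> e)) ` E"
  have in_S: "path_image q \<subseteq> S" if "path_image q \<subseteq> U i" "i \<in> J" for q i
    using that US by blast
  have \<alpha>\<beta>S: "path_image (\<alpha> e) \<subseteq> S" "path_image (\<beta> e) \<subseteq> S" if "e \<in> E" for e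
    using \<alpha>\<beta> that US by (auto simp: E_def) blast+
  have gens: "finite gens" "gens \<subseteq> carrier Q"
  proof -
    show "finite gens" using J E L(1) by (simp add: gens_def)
    have "holonomy l \<in> carrier Q" if "i \<in> J" "l \<in> L i" for i l
      using L(2)[OF that(1)] that(2) US[OF that(1)] by (intro holonomy_closed) (auto simp: based_loops_def)
    moreover have "holonomy (\<alpha> e +++ \<beta> e) \<in> carrier Q" if "e \<in> E" for e
      using \<alpha>\<beta> that \<alpha>\<beta>S[OF that] by (intro holonomy_closed) (auto simp: path_image_join)
    ultimately show "gens \<subseteq> carrier Q" by (auto simp: gens_def)
  qed
  define H where "H = generate Q gens"
  have H: "subgroup H Q" unfolding H_def by (rule generate_is_subgroup[OF gens(2)])
  interpret H: subgroup H Q by (rule H)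
  have gens_H: "gens \<subseteq> H" unfolding H_def by (auto intro: generate.incl)
  \<comment> \<open>The two paths differ by a loop in \<open>U i\<close>, whose holonomy lies in
    \<open>H\<close>.\<close>
  have same: "inv\<^bsub>Q\<^esub> holonomy d \<otimes>\<^bsub>Q\<^esub> holonomy d' \<in> H"
    if i: "i \<in> J" and d: "path d" "path_image d \<subseteq> U i" "pathfinish d = c i"
      and d': "path d'" "path_image d' \<subseteq> U i" "pathfinish d' = c i" "pathstart d' = pathstart d" for i d d'
  proof -
    have "reversepath d +++ d' \<in> based_loops (U i) (c i)"
      using d d' by (simp add: based_loops_def path_image_join)
    then have "holonomy (reversepath d +++ d') \<in> H"
      using holonomy_in_generated[OF US[OF i] c[OF i] L(2,3)[OF i] H] gens_H i by (auto simp: gens_def)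
    moreover have "holonomy (reversepath d +++ d') = holonomy (reversepath d) \<otimes>\<^bsub>Q\<^esub> holonomy d'"
      by (rule holonomy_join) (use d d' in_S[OF _ i] in auto)
    ultimately show ?thesis using holonomy_reverse d in_S[OF _ i] by simp
  qed
  have "\<forall>y\<in>S. \<exists>i d. i \<in> J \<and> y \<in> U i \<and> path d \<and> path_image d \<subseteq> U i \<and> pathstart d = y \<and> pathfinish d = c i"
  proof
    fix y assume "y \<in> S"
    then obtain i where "i \<in> J" "y \<in> U i" using S_eq by (auto simp: J_def)
    then show "\<exists>i d. i \<in> J \<and> y \<in> U i \<and> path d \<and> path_image d \<subseteq> U i \<and> pathstart d = y \<and> pathfinish d = c i"
      using path_in1 c by meson
  qed
  then obtain \<iota> \<delta> where "\<forall>y\<in>S. \<iota> y \<in> J \<and> y \<in> U (\<iota> y) \<and> path (\<delta> y) \<and> path_image (\<delta> y) \<subseteq> U (\<iota> y) \<and>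
      pathstart (\<delta> y) = y \<and> pathfinish (\<delta> y) = c (\<iota> y)"
    by metis
  then have \<delta>: "\<iota> y \<in> J" "y \<in> U (\<iota> y)" "path (\<delta> y)" "path_image (\<delta> y) \<subseteq> U (\<iota> y)"
      "pathstart (\<delta> y) = y" "pathfinish (\<delta> y) = c (\<iota> y)" if "y \<in> S" for y
    using that by blast+
  \<comment> \<open>By \<open>key\<close> below, another choice of piece and path at
    \<open>y\<close> changes \<open>w y\<close> only within its left coset of
    \<open>H\<close>.\<close>
  define w where "w y = holonomy (\<delta> y)" for y
  have w: "w y \<in> carrier Q" if "y \<in> S" for y
    unfolding w_def by (intro holonomy_closed \<delta>(3) in_S[OF \<delta>(4) \<delta>(1)] that)
  \<comment> \<open>In \<open>U (\<iota> y)\<close> the path \<open>\<delta> y\<close> is compared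
    with \<open>g\<close> followed by \<open>\<alpha> e\<close> reversed, in \<open>U i\<close> the
    path \<open>d\<close> with \<open>g\<close> followed by \<open>\<beta> e\<close>; the generator
    of the pair \<open>e\<close> links the two.\<close>
  have key: "inv\<^bsub>Q\<^esub> w y \<otimes>\<^bsub>Q\<^esub> holonomy d \<in> H"
    if i: "i \<in> J" and d: "path d" "path_image d \<subseteq> U i" "pathstart d = y" "pathfinish d = c i" for i d y
  proof -
    have yi: "y \<in> U i" using d by (metis pathstart_in_path_image subsetD)
    then have y: "y \<in> S" using US i by blast
    define e where "e = (\<iota> y, i)"
    have e: "e \<in> E" using \<delta>(1,2)[OF y] yi i by (auto simp: E_def e_def)
    have \<alpha>: "path (\<alpha> e)" "path_image (\<alpha> e) \<subseteq> U (\<iota> y)" "pathstart (\<alpha> e) = c (\<iota> y)"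
        "pathfinish (\<alpha> e) \<in> U (\<iota> y) \<inter> U i"
      and \<beta>: "path (\<beta> e)" "path_image (\<beta> e) \<subseteq> U i" "pathstart (\<beta> e) = pathfinish (\<alpha> e)" "pathfinish (\<beta> e) = c i"
      using bspec[OF \<alpha>\<beta> e] by (simp_all add: e_def)
    obtain g where g: "path g" "path_image g \<subseteq> U (\<iota> y) \<inter> U i" "pathstart g = y" "pathfinish g = pathfinish (\<alpha> e)"
      using path_in[of "\<iota> y" i y "pathfinish (\<alpha> e)"] \<delta>(1,2)[OF y] yi i \<alpha> by auto
    have gS: "path_image g \<subseteq> S" using g(2) US[OF i] by blast
    note S = gS \<alpha>\<beta>S[OF e] in_S[OF d(2) i]
    have c': "holonomy g \<in> carrier Q" "holonomy (\<alpha> e) \<in> carrier Q" "holonomy (\<beta> e) \<in> carrier Q"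
        "holonomy d \<in> carrier Q" "w y \<in> carrier Q"
      using holonomy_closed S g \<alpha> \<beta> d w y by auto
    have "inv\<^bsub>Q\<^esub> w y \<otimes>\<^bsub>Q\<^esub> holonomy (g +++ reversepath (\<alpha> e)) \<in> H"
      unfolding w_def using \<delta>[OF y] g \<alpha>
      by (intro same[of "\<iota> y"]) (auto simp: path_image_join)
    then have 1: "inv\<^bsub>Q\<^esub> w y \<otimes>\<^bsub>Q\<^esub> (holonomy g \<otimes>\<^bsub>Q\<^esub> inv\<^bsub>Q\<^esub> holonomy (\<alpha> e)) \<in> H"
      using holonomy_join[of g "reversepath (\<alpha> e)"] holonomy_reverse[of "\<alpha> e"] g \<alpha> S by simp
    have "inv\<^bsub>Q\<^esub> holonomy (g +++ \<beta> e) \<otimes>\<^bsub>Q\<^esub> holonomy d \<in> H"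
      using g \<beta> d by (intro same[OF i]) (auto simp: path_image_join)
    then have 2: "inv\<^bsub>Q\<^esub> (holonomy g \<otimes>\<^bsub>Q\<^esub> holonomy (\<beta> e)) \<otimes>\<^bsub>Q\<^esub> holonomy d \<in> H"
      using holonomy_join[of g "\<beta> e"] g \<beta> S by simp
    have "holonomy (\<alpha> e +++ \<beta> e) \<in> H" using gens_H e by (auto simp: gens_def)
    then have 3: "holonomy (\<alpha> e) \<otimes>\<^bsub>Q\<^esub> holonomy (\<beta> e) \<in> H"
      using holonomy_join[of "\<alpha> e" "\<beta> e"] \<alpha> \<beta> S by simp
    have cancel: "u \<otimes>\<^bsub>Q\<^esub> (inv\<^bsub>Q\<^esub> u \<otimes>\<^bsub>Q\<^esub> z) = z" "inv\<^bsub>Q\<^esub> u \<otimes>\<^bsub>Q\<^esub> (u \<otimes>\<^bsub>Q\<^esub> z) = z"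
      if "u \<in> carrier Q" "z \<in> carrier Q" for u z
      using that by (simp_all flip: m_assoc)
    have "(inv\<^bsub>Q\<^esub> w y \<otimes>\<^bsub>Q\<^esub> (holonomy g \<otimes>\<^bsub>Q\<^esub> inv\<^bsub>Q\<^esub> holonomy (\<alpha> e))) \<otimes>\<^bsub>Q\<^esub> (holonomy (\<alpha> e) \<otimes>\<^bsub>Q\<^esub> holonomy (\<beta> e))
       \<otimes>\<^bsub>Q\<^esub> (inv\<^bsub>Q\<^esub> (holonomy g \<otimes>\<^bsub>Q\<^esub> holonomy (\<beta> e)) \<otimes>\<^bsub>Q\<^esub> holonomy d) \<in> H"
      by (rule H.m_closed[OF H.m_closed[OF 1 3] 2])
    then show ?thesis
      using c' by (simp add: m_assoc inv_mult_group cancel)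
  qed
  have "H = carrier Q"
  proof (rule local_paths_generate[OF H w])
    fix y assume "y \<in> S"
    then obtain i where i: "i \<in> J" "y \<in> U i" using \<delta>(1,2) by blast
    have "inv\<^bsub>Q\<^esub> w (pathstart q) \<otimes>\<^bsub>Q\<^esub> holonomy q \<otimes>\<^bsub>Q\<^esub> w (pathfinish q) \<in> H"
      if q: "path q" "path_image q \<subseteq> U i" for q
    proof -
      have qi: "pathstart q \<in> U i" "pathfinish q \<in> U i"
        using q(2) by (auto simp: pathstart_in_path_image pathfinish_in_path_image subset_iff)
      \<comment> \<open>Both \<open>d\<close> and \<open>q\<close> followed by \<open>d\<close> stay
        in \<open>U i\<close> and end at \<open>c i\<close>, so \<open>key\<close> applies to each;
        \<open>holonomy d\<close> cancels in the quotient.\<close>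
      obtain d where d: "path d" "path_image d \<subseteq> U i" "pathstart d = pathfinish q" "pathfinish d = c i"
        using path_in1[OF i(1) qi(2) c[OF i(1)]] by blast
      have S: "path_image q \<subseteq> S" "path_image d \<subseteq> S" "pathstart q \<in> S" "pathfinish q \<in> S"
        using q d qi US[OF i(1)] by auto
      have c': "holonomy q \<in> carrier Q" "holonomy d \<in> carrier Q" "w (pathstart q) \<in> carrier Q" "w (pathfinish q) \<in> carrier Q"
        using S q d w holonomy_closed by auto
      have "inv\<^bsub>Q\<^esub> w (pathstart q) \<otimes>\<^bsub>Q\<^esub> holonomy (q +++ d) \<in> H"
        using q d by (intro key[OF i(1)]) (auto simp: path_image_join)
      then have 1: "inv\<^bsub>Q\<^esub> w (pathstart q) \<otimes>\<^bsub>Q\<^esub> (holonomy q \<otimes>\<^bsub>Q\<^esub> holonomy d) \<in> H"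
        using holonomy_join[of q d] q d S by simp
      have 2: "inv\<^bsub>Q\<^esub> w (pathfinish q) \<otimes>\<^bsub>Q\<^esub> holonomy d \<in> H"
        using d by (intro key[OF i(1)]) auto
      have "(inv\<^bsub>Q\<^esub> w (pathstart q) \<otimes>\<^bsub>Q\<^esub> (holonomy q \<otimes>\<^bsub>Q\<^esub> holonomy d)) \<otimes>\<^bsub>Q\<^esub>
          inv\<^bsub>Q\<^esub> (inv\<^bsub>Q\<^esub> w (pathfinish q) \<otimes>\<^bsub>Q\<^esub> holonomy d) \<in> H"
        by (rule H.m_closed[OF 1 H.m_inv_closed[OF 2]])
      moreover have "holonomy d \<otimes>\<^bsub>Q\<^esub> (inv\<^bsub>Q\<^esub> holonomy d \<otimes>\<^bsub>Q\<^esub> z) = z" if "z \<in> carrier Q" for z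
        using that c' by (simp flip: m_assoc)
      ultimately show ?thesis
        using c' by (simp add: m_assoc inv_mult_group)
    qed
    then show "\<exists>V. openin (top_of_set S) V \<and> y \<in> V \<and> (\<forall>q. path q \<and> path_image q \<subseteq> V \<longrightarrow>
        inv\<^bsub>Q\<^esub> w (pathstart q) \<otimes>\<^bsub>Q\<^esub> holonomy q \<otimes>\<^bsub>Q\<^esub> w (pathfinish q) \<in> H)"
      using op[of i] i by (intro exI[of _ "U i"]) (auto simp: J_def)
  qed
  then show ?thesis
    unfolding finitely_generated_def H_def using gens by blast
qed

section \<open>Knot groups\<close>

text \<open>A segment is a finite intersection of closed half-spaces, so its complement is a finite
  union of open ones; the complement of finitely many segments is obtained by distributing
  intersections over unions.\<close>

lemma complement_polygonal_convex_cover: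
  fixes K :: "'a::euclidean_space set"
  assumes "polygonal K"
  shows "\<exists>\<F>. finite \<F> \<and> (\<forall>C\<in>\<F>. open C \<and> convex C) \<and> - K = \<Union>\<F>"
proof -
  obtain E where E: "finite E" "K = (\<Union>(u, v)\<in>E. closed_segment u v)"
    using assms by (auto simp: polygonal_def)
  have "\<exists>\<F>. finite \<F> \<and> (\<forall>C\<in>\<F>. open C \<and> convex C) \<and> - (\<Union>(u, v)\<in>E. closed_segment u v) = \<Union>\<F>"
    using E(1)
  proof (induction E rule: finite_induct)
    case empty
    show ?case by (intro exI[of _ "{UNIV}"]) auto
  next
    case (insert e E)
    obtain u v where e: "e = (u, v)" by (cases e)
    obtain \<F> where \<F>: "finite \<F>" "\<And>C. C \<in> \<F> \<Longrightarrow> open C \<and> convex C"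
        "- (\<Union>(u, v)\<in>E. closed_segment u v) = \<Union>\<F>"
      using insert.IH by blast
    have "polyhedron (closed_segment u v)"
      by (simp add: polytope_imp_polyhedron polytope_convex_hull segment_convex_hull)
    then obtain \<H> where \<H>: "finite \<H>" "closed_segment u v = \<Inter>\<H>"
        "\<forall>h\<in>\<H>. \<exists>a b. a \<noteq> 0 \<and> h = {x. a \<bullet> x \<le> b}"
      by (auto simp: polyhedron_def)
    have half: "open (- h) \<and> convex (- h)" if "h \<in> \<H>" for h
    proof -
      obtain a b where "h = {x. a \<bullet> x \<le> b}" using \<H>(3) \<open>h \<in> \<H>\<close> by blast
      then have "- h = {x. a \<bullet> x > b}" by auto
      then show ?thesis by (simp add: open_halfspace_gt convex_halfspace_gt)
    qed
    define \<G> where "\<G> = (\<lambda>(C, h). C \<inter> - h) ` (\<F> \<times> \<H>)"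
    have "finite \<G>" using \<F>(1) \<H>(1) by (simp add: \<G>_def)
    moreover have "open C \<and> convex C" if "C \<in> \<G>" for C
      using that \<F>(2) half by (auto simp: \<G>_def open_Int convex_Int)
    moreover have "- (\<Union>(u, v)\<in>insert e E. closed_segment u v) = \<Union>\<G>"
    proof -
      have "- (\<Union>(u, v)\<in>insert e E. closed_segment u v) = \<Union>\<F> \<inter> - \<Inter>\<H>"
        unfolding \<F>(3)[symmetric] \<H>(2)[symmetric] by (auto simp: e)
      also have "\<dots> = \<Union>\<G>" by (auto simp: \<G>_def)
      finally show ?thesis .
    qed
    ultimately show ?case by blast
  qed
  then show ?thesis by (simp only: E(2))
qed

text \<open>Two points are joined through a third point \<open>w\<close>. The segment from
  \<open>x\<close> to \<open>w\<close> can meet the one from \<open>u\<close> to \<open>v\<close>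
  only if \<open>w\<close> lies in the affine hull of \<open>x\<close>, \<open>u\<close>,
  \<open>v\<close>, which is at most a plane; finitely many such sets do not fill the space.\<close>

lemma path_connected_complement_polygonal:
  fixes K :: "'a::euclidean_space set"
  assumes "polygonal K" and dim: "DIM('a) \<ge> 3"
  shows "path_connected (- K)"
proof -
  obtain E where E: "finite E" "K = (\<Union>(u, v)\<in>E. closed_segment u v)"
    using assms by (auto simp: polygonal_def)
  have neg: "negligible (affine hull {x, u, v})" for x u v :: 'a
  proof -
    have "aff_dim {x, u, v} \<le> int (card {x, u, v}) - 1" by (rule aff_dim_le_card) simp
    moreover have "card {x, u, v} \<le> 3" by (simp add: card_insert_if)
    ultimately have "aff_dim {x, u, v} < DIM('a)" using dim by linarith
    then obtain a b where "a \<noteq> 0" "{x, u, v} \<subseteq> {x. a \<bullet> x = b}"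
      by (rule aff_lowdim_subset_hyperplane)
    then have "affine hull {x, u, v} \<subseteq> {x. a \<bullet> x = b}"
      by (intro hull_minimal) (auto simp: affine_hyperplane)
    then show ?thesis
      using negligible_hyperplane[of a b] \<open>a \<noteq> 0\<close> negligible_subset by blast
  qed
  have avoid: "closed_segment x w \<inter> K = {}"
    if x: "x \<notin> K" and w: "w \<notin> (\<Union>(u, v)\<in>E. affine hull {x, u, v})" for x w
  proof (rule ccontr)
    assume "closed_segment x w \<inter> K \<noteq> {}"
    then obtain y u v where y: "y \<in> closed_segment x w" "y \<in> K" "(u, v) \<in> E" "y \<in> closed_segment u v"
      using E(2) by blast
    obtain s where s: "y = (1 - s) *\<^sub>R x + s *\<^sub>R w" using y(1) by (auto simp: closed_segment_def)
    \<comment> \<open>If \<open>s = 0\<close>, then \<open>x = y\<close> would lie in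
      \<open>K\<close>; so \<open>w\<close> can be solved for on the line through \<open>x\<close>
      and \<open>y\<close>.\<close>
    have "s \<noteq> 0" using s x y(2) by auto
    then have "w = (1 - 1 / s) *\<^sub>R x + (1 / s) *\<^sub>R y"
      by (simp add: s algebra_simps)
    moreover have "x \<in> affine hull {x, u, v}" by (simp add: hull_inc)
    moreover have "y \<in> affine hull {x, u, v}"
      using y(4) convex_hull_subset_affine_hull[of "{u, v}"] hull_mono[of "{u, v}" "{x, u, v}" affine]
      by (auto simp: segment_convex_hull)
    ultimately have "w \<in> affine hull {x, u, v}"
      using affine_affine_hull[of "{x, u, v}"] by (auto intro: mem_affine)
    then show False using w y(3) by blast
  qed
  show ?thesis
    unfolding path_connected_component
  proof (intro ballI)
    fix x y assume xy: "x \<in> - K" "y \<in> - K"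
    have "negligible ((\<Union>(u, v)\<in>E. affine hull {x, u, v}) \<union> (\<Union>(u, v)\<in>E. affine hull {y, u, v}))"
      using E(1) neg by (intro negligible_Un negligible_Union) auto
    then have "(\<Union>(u, v)\<in>E. affine hull {x, u, v}) \<union> (\<Union>(u, v)\<in>E. affine hull {y, u, v}) \<noteq> UNIV"
      by (metis non_negligible_UNIV)
    then obtain w where w: "w \<notin> (\<Union>(u, v)\<in>E. affine hull {x, u, v})" "w \<notin> (\<Union>(u, v)\<in>E. affine hull {y, u, v})"
      by blast
    have "path_component (- K) z w" if "closed_segment z w \<inter> K = {}" for z
      unfolding path_component_def using that by (intro exI[of _ "linepath z w"]) auto
    then have "path_component (- K) x w" "path_component (- K) y w"
      using avoid xy w by auto
    then show "path_component (- K) x y"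
      using path_component_sym path_component_trans by blast
  qed
qed

text \<open>The polygonal chart misses \<open>p\<close>, a point of the knot complement. So the
  complement is covered by \<open>A\<close>, a copy of the complement of a polygon, and a small ball
  \<open>W\<close> around \<open>p\<close>. The theorem on covers is applied to \<open>A\<close> and
  then to this pair.\<close>

theorem finitely_generated_knot_group:
  assumes k: "tame_knot k" and a: "a \<in> S3 - k"
  shows "finitely_generated (fundamental_group (S3 - k) a)"
proof -
  obtain p and f :: "real ^ 4 \<Rightarrow> real ^ 3" and g where p: "p \<in> S3" "p \<notin> k"
    and fg: "homeomorphism (S3 - {p}) UNIV f g" and K: "polygonal (f ` k)"
    using k by (auto simp: tame_knot_def)
  have kS: "k \<subseteq> S3" and "closed k"
    using k compact_imp_closed[OF compact_simple_path_image] by (auto simp: tame_knot_def knot_def)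
  define A where "A = S3 - k - {p}"
  have fk: "f ` A = - f ` k"
  proof -
    have inj: "inj_on f (S3 - {p})"
      by (rule inj_on_inverseI) (rule homeomorphism_apply1[OF fg])
    have "f ` ((S3 - {p}) - k) = f ` (S3 - {p}) - f ` k"
      using inj kS p by (intro inj_on_image_set_diff[of _ "S3 - {p}"]) auto
    then show ?thesis using fg by (auto simp: A_def homeomorphism_def set_diff_eq)
  qed
  have gA: "homeomorphism (- f ` k) A g f"
    using homeomorphism_of_subsets[OF fg, of A "- f ` k" "- f ` k"] fk
    by (auto simp: A_def intro: homeomorphism_symD)
  obtain \<F> where \<F>: "finite \<F>" "\<And>C. C \<in> \<F> \<Longrightarrow> open C \<and> convex C" "- f ` k = \<Union>\<F>"
    using complement_polygonal_convex_cover[OF K] by blast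
  have pc: "path_connected (- f ` k)"
    by (rule path_connected_complement_polygonal[OF K]) simp
  have gcont: "continuous_on (- f ` k) g" and gimg: "g ` (- f ` k) = A"
    using gA by (auto simp: homeomorphism_def)
  have ginj: "inj_on g (- f ` k)"
    by (rule inj_on_inverseI) (rule homeomorphism_apply1[OF gA])
  have A_pc: "path_connected A"
    using path_connected_continuous_image[OF gcont pc] gimg by simp
  have A_fg: "finitely_generated (fundamental_group A c)" if c: "c \<in> A" for c
  proof (rule finitely_generated_cover[OF \<F>(1), of A "\<lambda>C. g ` C"])
    show "A = (\<Union>C\<in>\<F>. g ` C)" using gimg \<F>(3) by (metis image_Union)
    show "openin (top_of_set A) (g ` C)" if C: "C \<in> \<F>" for C
    proof (rule homeomorphism_imp_open_map[OF gA])
      show "openin (top_of_set (- f ` k)) C"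
        using C \<F> by (intro open_openin_trans) auto
    qed
    show "path_connected (g ` C \<inter> g ` D)" if CD: "C \<in> \<F>" "D \<in> \<F>" for C D
    proof -
      have sub: "C \<subseteq> - f ` k" "D \<subseteq> - f ` k" using CD \<F>(3) by auto
      have "g ` C \<inter> g ` D = g ` (C \<inter> D)" by (rule inj_on_image_Int[OF ginj sub, symmetric])
      moreover have "path_connected (C \<inter> D)"
        using CD \<F>(2) by (simp add: convex_Int convex_imp_path_connected)
      ultimately show ?thesis
        using sub continuous_on_subset[OF gcont, of "C \<inter> D"]
        by (auto intro: path_connected_continuous_image)
    qed
    show "finitely_generated (fundamental_group (g ` C) c)" if C: "C \<in> \<F>" "c \<in> g ` C" for C c
    proof (rule finitely_generated_simply_connected[OF _ C(2)])
      have "homeomorphism C (g ` C) g f"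
        by (rule homeomorphism_of_subsets[OF gA]) (use C \<F>(3) gimg in auto)
      then show "simply_connected (g ` C)"
        using C \<F>(2) convex_imp_simply_connected homeomorphic_simply_connected homeomorphic_def by blast
    qed
    show "path_connected A" by (rule A_pc)
    show "c \<in> A" by (rule c)
  qed
  \<comment> \<open>Removing the antipode of \<open>p\<close> leaves a chart around
    \<open>p\<close>, modelled on the hyperplane \<open>T\<close>. Its dimension three keeps a ball
    path connected after \<open>p\<close> is removed.\<close>
  define q where "q = - p"
  have "p \<noteq> 0" using p by (auto simp: S3_def)
  then have "p + p \<noteq> 0" by (simp flip: scaleR_2)
  then have q: "q \<in> S3" "p \<noteq> q" "q \<noteq> 0"
    using p unfolding q_def by (auto simp: S3_def eq_neg_iff_add_eq_0)
  define T where "T = {x. q \<bullet> x = 0}"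
  have T: "convex T" "aff_dim T = 3"
    using q by (simp_all add: T_def convex_hyperplane aff_dim_hyperplane)
  have "(S3 - {q}) homeomorphic T"
    unfolding S3_def T_def by (rule homeomorphic_punctured_sphere_hyperplane) (use q S3_def in auto)
  then obtain h h' where h: "homeomorphism (S3 - {q}) T h h'" by (auto simp: homeomorphic_def)
  have hp: "h p \<in> T" "h' (h p) = p" using h p q by (auto simp: homeomorphism_def)
  have op: "openin (top_of_set T) (h ` (S3 - {q} - k))"
    unfolding Diff_eq[of _ k]
    by (intro homeomorphism_imp_open_map[OF h] openin_open_Int open_Compl) fact
  obtain e where e: "e > 0" "T \<inter> ball (h p) e \<subseteq> h ` (S3 - {q} - k)"
  proof -
    have "h p \<in> h ` (S3 - {q} - k)" using p q by auto
    then show ?thesis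
      using op that unfolding openin_contains_ball by (metis Int_commute)
  qed
  define B where "B = T \<inter> ball (h p) e"
  have B: "convex B" "aff_dim B = 3" "openin (top_of_set T) B"
  proof -
    show "convex B" using T by (simp add: B_def convex_Int)
    have "T \<inter> ball (h p) e \<noteq> {}" using hp e by auto
    then show "aff_dim B = 3" unfolding B_def using aff_dim_convex_Int_open[of T "ball (h p) e"] T by simp
    show "openin (top_of_set T) B" by (simp add: B_def openin_open_Int)
  qed
  define W where "W = h' ` B"
  have BT: "B \<subseteq> T" by (simp add: B_def)
  have hW: "homeomorphism B W h' h"
    unfolding W_def
    by (rule homeomorphism_of_subsets[OF homeomorphism_symD[OF h] BT subset_refl refl])
  have W_sub: "W \<subseteq> S3 - k"
  proof
    fix z assume "z \<in> W"
    then obtain x where "x \<in> S3 - {q} - k" "z = h' (h x)" using e(2) by (auto simp: W_def B_def)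
    then show "z \<in> S3 - k" using h by (simp add: homeomorphism_def)
  qed
  have pW: "p \<in> W" using hp e by (auto simp: W_def B_def intro!: image_eqI[of _ h' "h p"])
  have W_open: "openin (top_of_set (S3 - k)) W"
  proof (rule openin_subset_trans)
    have "openin (top_of_set (S3 - {q})) W"
      unfolding W_def by (rule homeomorphism_imp_open_map[OF homeomorphism_symD[OF h] B(3)])
    moreover have "openin (top_of_set S3) (S3 - {q})" by (simp add: openin_delete)
    ultimately show "openin (top_of_set S3) W" by (rule openin_trans)
  qed (use W_sub in auto)
  have W_p: "W - {p} = h' ` (B - {h p})"
    using hW hp pW by (auto simp: homeomorphism_def W_def)
  have Wp_pc: "path_connected (W - {p})"
    unfolding W_p
  proof (rule path_connected_continuous_image)
    show "continuous_on (B - {h p}) h'" using hW by (auto simp: homeomorphism_def intro: continuous_on_subset)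
    show "path_connected (B - {h p})" using B by (intro path_connected_punctured_convex) auto
  qed
  have "W - {p} \<noteq> {}"
  proof
    assume "W - {p} = {}"
    then have "B \<subseteq> {h p}" using W_p by auto
    then have "aff_dim B \<le> 0" using aff_dim_subset aff_dim_sing by metis
    then show False using B(2) by simp
  qed
  have W_sc: "simply_connected W"
    using convex_imp_simply_connected[OF B(1)] hW homeomorphic_simply_connected homeomorphic_def by blast
  have AW: "A \<inter> W = W - {p}" "A \<union> W = S3 - k" using W_sub pW by (auto simp: A_def)
  have X_pc: "path_connected (S3 - k)"
    unfolding AW(2)[symmetric]
    by (rule path_connected_Un[OF A_pc simply_connected_imp_path_connected[OF W_sc]])
      (use AW \<open>W - {p} \<noteq> {}\<close> in simp)
  define U where "U b = (if b then A else W)" for b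
  show ?thesis
  proof (rule finitely_generated_cover[of "UNIV :: bool set" "S3 - k" U])
    show "S3 - k = (\<Union>b\<in>UNIV. U b)" using AW(2) by (auto simp: U_def UNIV_bool)
    show "openin (top_of_set (S3 - k)) (U b)" for b
      using W_open by (simp add: U_def A_def openin_delete)
    show "path_connected (U b \<inter> U c)" for b c
      using A_pc Wp_pc AW(1) simply_connected_imp_path_connected[OF W_sc]
      by (auto simp: U_def Int_commute)
    show "finitely_generated (fundamental_group (U b) c)" if "c \<in> U b" for b c
      using that A_fg finitely_generated_simply_connected[OF W_sc] by (auto simp: U_def split: if_splits)
  qed (use X_pc a in auto)
qed

theorem corollary4p5:
  fixes k :: "(real ^ 4) set" and a :: "real ^ 4"
    and G :: "(real \<Rightarrow> real ^ 4) set monoid"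
    and \<phi> :: "(real \<Rightarrow> real ^ 4) set \<Rightarrow> int"
    and x :: "(real \<Rightarrow> real ^ 4) set"
    and b :: "nat \<Rightarrow> nat"
  assumes "tame_knot k"
    and "a \<in> S3 - k"
    and "G = fundamental_group (S3 - k) a"
    and "is_abelianization_int G \<phi>"
    and "x \<in> carrier G" and "\<phi> x = 1"
    and "\<And>r. r \<ge> 1 \<Longrightarrow> b r = torsion_number G \<phi> x r"
  shows "(\<exists>p\<ge>1. \<forall>r\<ge>1. b (r + p) = b r) \<or>
         (\<forall>N::nat. N > 0 \<longrightarrow> (\<exists>r\<ge>1. card (prime_factors (b r)) \<ge> N))"
proof -
  have G: "group G"
    unfolding assms(3) by (rule group_fundamental_group) (rule assms(2))
  obtain F where "finite F" "F \<subseteq> carrier G" "generate G F = carrier G"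
    using finitely_generated_knot_group[OF assms(1,2)] by (auto simp: assms(3) finitely_generated_def)
  then show ?thesis
    using torsion_number_dichotomy[OF G assms(4-6) _ _ _ assms(7)] by blast
qed

end
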